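(* Let $\mu$ be a measure on $\mathbb{R}$ with compact support $E$ with $C(E)>0$, with Jacobi parameters $\{a_n,b_n\}_{n\ge1}$. Let $n(1)<n(2)<\cdots$ be a subsequence such that the zero counting measures $\nu_{n(j)}$ of the orthonormal polynomials $p_{n(j)}$ converge weakly to $\rho_E$, the equilibrium measure of $E$. Then either (a) $\lim_{j\to\infty}(a_1\cdots a_{n(j)})^{1/n(j)}=C(E)$, or (b) there is a Borel set $X\subset E$ with $C(X)=0$ and $\mu(\mathbb{R}\setminus X)=0$.
   Context: Capacity: for compact $K\subset\mathbb{C}$, $C(K)=\exp(-\inf\{\iint\log|x-y|^{-1}d\nu(x)d\nu(y):\nu \text{ probability on } K\})$; for Borel $X$, $C(X)=\sup\{C(K):K\subset X\text{ compact}\}$. If $C(K)>0$, $\rho_K$ is the unique probability measure on $K$ attaining the infimum. Jacobi parameters: the orthonormal polynomials obey $xp_n=a_{n+1}p_{n+1}+b_{n+1}p_n+a_np_{n-1}$ with $a_n>0$. The zero counting measure of $p_n$ is $\frac1n\sum\delta_{z_j}$ over its zeros with multiplicity. *)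

theory Defs
  imports "HOL-Analysis.Analysis" "HOL-Probability.Probability"
          "HOL-Computational_Algebra.Polynomial"
begin

definition log_kernel_pos :: "complex \<times> complex \<Rightarrow> ennreal" where
  "log_kernel_pos = (\<lambda>(x,y). if x = y then \<infinity> else ennreal (- ln (cmod (x - y))))"

definition log_kernel_neg :: "complex \<times> complex \<Rightarrow> ennreal" where
  "log_kernel_neg = (\<lambda>(x,y). if x = y then 0 else ennreal (ln (cmod (x - y))))"

definition log_energy :: "complex measure \<Rightarrow> ereal" where
  "log_energy nu =
     enn2ereal (\<integral>\<^sup>+ z. log_kernel_pos z \<partial>(nu \<Otimes>\<^sub>M nu))
   - enn2ereal (\<integral>\<^sup>+ z. log_kernel_neg z \<partial>(nu \<Otimes>\<^sub>M nu))"

definition prob_measures_on :: "complex set \<Rightarrow> complex measure set" where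
  "prob_measures_on K =
     {nu. prob_space nu \<and> sets nu = sets borel \<and> emeasure nu (UNIV - K) = 0}"

definition min_energy :: "complex set \<Rightarrow> ereal" where
  "min_energy K = (INF nu \<in> prob_measures_on K. log_energy nu)"

definition cap_compact :: "complex set \<Rightarrow> real" where
  "cap_compact K = (if min_energy K = \<infinity> then 0 else exp (- real_of_ereal (min_energy K)))"

definition capacity :: "complex set \<Rightarrow> real" where
  "capacity X = (SUP K \<in> {K. compact K \<and> K \<subseteq> X}. cap_compact K)"

definition equilibrium_measure :: "complex set \<Rightarrow> complex measure \<Rightarrow> bool" where
  "equilibrium_measure K rho \<longleftrightarrow> rho \<in> prob_measures_on K \<and> log_energy rho = min_energy K"

definition measure_support :: "real measure \<Rightarrow> real set" where
  "measure_support mu = {x. \<forall>e>0. emeasure mu (ball x e) > 0}"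

definition orthonormal_polys :: "real measure \<Rightarrow> (nat \<Rightarrow> real poly) \<Rightarrow> bool" where
  "orthonormal_polys mu p \<longleftrightarrow>
     (\<forall>n. degree (p n) = n \<and> lead_coeff (p n) > 0) \<and>
     (\<forall>m n. (\<integral>x. poly (p m) x * poly (p n) x \<partial>mu) = (if m = n then 1 else 0))"

definition jacobi_parameters :: "(nat \<Rightarrow> real poly) \<Rightarrow> (nat \<Rightarrow> real) \<Rightarrow> (nat \<Rightarrow> real) \<Rightarrow> bool" where
  "jacobi_parameters p a b \<longleftrightarrow>
     (\<forall>n\<ge>1. a n > 0) \<and>
     (\<forall>n. [:0, 1:] * p n =
            smult (a (n + 1)) (p (n + 1)) + smult (b (n + 1)) (p n)
          + (if n = 0 then 0 else smult (a n) (p (n - 1))))"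

definition zero_counting_measure :: "real poly \<Rightarrow> complex measure" where
  "zero_counting_measure q =
     measure_of UNIV (sets borel)
       (\<lambda>A. ennreal ((\<Sum>z \<in> {z. poly (map_poly complex_of_real q) z = 0} \<inter> A.
                        real (order z (map_poly complex_of_real q))) / real (degree q)))"

definition weak_conv_complex :: "(nat \<Rightarrow> complex measure) \<Rightarrow> complex measure \<Rightarrow> bool" where
  "weak_conv_complex nus rho \<longleftrightarrow>
     (\<forall>f :: complex \<Rightarrow> real. continuous_on UNIV f \<and> bounded (range f) \<longrightarrow>
        (\<lambda>j. \<integral>x. f x \<partial>(nus j)) \<longlonglongrightarrow> (\<integral>x. f x \<partial>rho))"

end

theory Submission
  imports Defs "HOL-Computational_Algebra.Fundamental_Theorem_Algebra"
begin

text \<open>Fix \<open>R \<ge> 1\<close> above the diameter of \<open>E\<close> and work with the nonnegative kernel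
  \<open>ln (R / \<bar>x - y\<bar>)\<close>, whose minimal energy on \<open>E\<close> is \<open>V\<close> with \<open>C(E) = R exp (- V)\<close>.
  Choosing points of \<open>E\<close> greedily, one finds a monic polynomial, of some degree \<open>k\<close>, whose
  maximum on \<open>E\<close> has \<open>k\<close>-th root at most about \<open>C(E)\<close>. By comparison with its powers, the
  minimality of the monic orthogonal polynomials \<open>P\<^sub>n\<close> in \<open>L\<^sup>2(\<mu>)\<close> shows that the upper limit of
  \<open>(a\<^sub>1 \<dots> a\<^sub>n)\<^bsup>1/n\<^esup>\<close> never exceeds \<open>C(E)\<close>. If (a) fails, then along a further subsequence
  these roots stay below some \<open>A < C(E)\<close>; by Borel-Cantelli, for every \<open>B\<close> between \<open>A\<close> and \<open>C(E)\<close>,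
  \<open>\<bar>P\<^sub>n\<bar> \<le> B\<^sup>n\<close> holds eventually on a set \<open>X\<close> carrying \<open>\<mu>\<close>. If \<open>X\<close> had positive capacity, it would
  carry a probability measure with continuous potential. Integrating \<open>ln \<bar>P\<^sub>n\<bar> / n\<close> against it, and using
  the weak convergence of the zeros together with the Frostman bound \<open>U\<^sup>\<rho> \<le> V\<close>, gives
  \<open>C(E) \<le> B\<close>, a contradiction.\<close>

section \<open>The truncated logarithmic kernel\<close>

text \<open>For \<open>t > 0\<close> this is \<open>ln (R / t)\<close> clamped to the interval from
  0 to \<open>n\<close>. Clamping the argument of the logarithm rather than its value makes the
  function finite and Lipschitz even at \<open>t = 0\<close>.\<close>

definition log_trunc :: "real \<Rightarrow> nat \<Rightarrow> real \<Rightarrow> real" where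
  "log_trunc R n t = - ln (min 1 (max (t / R) (exp (- real n))))"

text \<open>The value at \<open>0\<close> is set by hand because of \<open>R / 0 = 0\<close>; as \<open>ennreal\<close> maps negative numbers
  to \<open>0\<close>, the kernel is cut off at distances above \<open>R\<close>.\<close>
definition log_pos :: "real \<Rightarrow> real \<Rightarrow> ennreal" where
  "log_pos R t = (if t = 0 then \<infinity> else ennreal (ln (R / t)))"

lemma clamp_pos: "0 < min 1 (max (t / R) (exp (- real n)))"
  by (simp add: less_max_iff_disj)

lemma log_trunc_nonneg: "0 \<le> log_trunc R n t"
  using ln_le_cancel_iff[OF clamp_pos[of t R n], of 1] by (simp add: log_trunc_def)

lemma log_trunc_le: "log_trunc R n t \<le> real n"
proof -
  have "ln (exp (- real n)) \<le> ln (min 1 (max (t / R) (exp (- real n))))"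
    by (subst ln_le_cancel_iff) (use clamp_pos[of t R n] in auto)
  then show ?thesis by (simp add: log_trunc_def)
qed

lemma log_trunc_norm_le: "norm (log_trunc R n t) \<le> real n"
  using log_trunc_nonneg[of R n t] log_trunc_le[of R n t] by simp

text \<open>The clamped argument never falls below \<open>exp (- n)\<close>, where the slope of
  \<open>ln\<close> is at most \<open>exp n\<close>; the scaling \<open>t / R\<close> contributes
  the factor \<open>1 / R\<close>.\<close>

lemma log_trunc_lipschitz:
  assumes "R > 0"
  shows "\<bar>log_trunc R n s - log_trunc R n t\<bar> \<le> exp (real n) / R * \<bar>s - t\<bar>"
proof -
  have *: "log_trunc R n s - log_trunc R n t \<le> exp (real n) / R * (t - s)
           \<and> log_trunc R n t \<le> log_trunc R n s" if "s \<le> t" for s t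
  proof -
    define u where "u = min 1 (max (s / R) (exp (- real n)))"
    define v where "v = min 1 (max (t / R) (exp (- real n)))"
    have sR: "s / R \<le> t / R" using that assms by (simp add: divide_right_mono)
    have u: "exp (- real n) \<le> u" by (auto simp: u_def)
    then have u0: "u > 0" using exp_gt_zero[of "- real n"] by linarith
    have uv: "u \<le> v" using sR by (auto simp: u_def v_def)
    have vu: "v - u \<le> (t - s) / R" using sR by (auto simp: u_def v_def diff_divide_distrib)
    have "ln v - ln u = ln (v / u)" using u0 uv by (simp add: ln_div)
    also have "\<dots> \<le> v / u - 1" using u0 uv by (intro ln_le_minus_one) auto
    also have "\<dots> = (v - u) / u" using u0 by (simp add: field_simps)
    also have "\<dots> \<le> (v - u) / exp (- real n)" using u uv u0 by (intro divide_left_mono) auto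
    also have "\<dots> = exp (real n) * (v - u)" by (simp add: exp_minus field_simps)
    also have "\<dots> \<le> exp (real n) * ((t - s) / R)" using vu by (intro mult_left_mono) auto
    finally have "ln v - ln u \<le> exp (real n) / R * (t - s)" by simp
    moreover have "ln u \<le> ln v" using u0 uv by simp
    ultimately show ?thesis unfolding log_trunc_def u_def v_def by simp
  qed
  show ?thesis
    using *[of s t] *[of t s] by (cases "s \<le> t") (auto simp: abs_if)
qed

lemma continuous_log_trunc: "continuous_on A (log_trunc R n)"
  unfolding log_trunc_def
proof (cases "R = 0")
  case False
  then show "continuous_on A (\<lambda>t. - ln (min 1 (max (t / R) (exp (- real n)))))"
    using clamp_pos[of _ R n, THEN less_imp_neq, THEN not_sym] by (intro continuous_intros) blast+
qed auto

lemma log_trunc_measurable [measurable]: "log_trunc R n \<in> borel_measurable borel"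
  by (intro borel_measurable_continuous_onI continuous_log_trunc)

lemma log_pos_measurable [measurable]: "log_pos R \<in> borel_measurable borel"
  unfolding log_pos_def by measurable

lemma log_trunc_0: "log_trunc R n 0 = real n"
  by (simp add: log_trunc_def)

lemma log_trunc_eq:
  assumes "R > 0" "t > 0"
  shows "log_trunc R n t = max 0 (min (real n) (ln (R / t)))"
proof -
  have m: "ln (max (t / R) (exp (- real n))) = max (ln (t / R)) (- real n)"
    using assms by (auto simp: max_def ln_ge_iff) (metis divide_pos_pos ln_exp ln_le_cancel_iff exp_gt_zero order.asym linorder_not_le)+
  have "ln (min 1 (max (t / R) (exp (- real n)))) = min 0 (ln (max (t / R) (exp (- real n))))"
    using assms by (auto simp: min_def max_def)
  then show ?thesis using assms unfolding log_trunc_def m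
    by (simp add: ln_div min_def max_def)
qed

text \<open>What truncation at height \<open>n\<close> cuts off is a kernel of the same form with
  \<open>R\<close> shrunk by \<open>exp (- n)\<close>. Tails of potentials are therefore potentials
  themselves, and all lemmas on potentials apply to them.\<close>

lemma log_pos_split:
  assumes "R > 0" "t \<ge> 0"
  shows "log_pos R t = ennreal (log_trunc R n t) + log_pos (R * exp (- real n)) t"
proof (cases "t = 0")
  case False
  then have t: "t > 0" using assms by simp
  have e: "ln (R * exp (- real n) / t) = ln (R / t) - real n"
    using assms t by (simp add: ln_div ln_mult)
  show ?thesis
  proof (cases "ln (R / t) \<ge> real n")
    case True
    then show ?thesis using assms t
      by (simp add: log_pos_def log_trunc_eq e flip: ennreal_plus)
  next
    case F: False
    have "ennreal (ln (R * exp (- real n) / t)) = 0" "log_trunc R n t = max 0 (ln (R / t))"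
      using F assms t by (auto simp: e log_trunc_eq intro!: ennreal_neg)
    then show ?thesis using t by (simp add: log_pos_def ennreal_max_0 max.commute)
  qed
qed (simp add: log_pos_def)

lemma log_trunc_le_log_pos:
  assumes "R > 0" "t \<ge> 0"
  shows "ennreal (log_trunc R n t) \<le> log_pos R t"
  by (subst log_pos_split[OF assms, of n]) simp

lemma log_trunc_mono:
  assumes "R > 0" "t \<ge> 0" "m \<le> n"
  shows "log_trunc R m t \<le> log_trunc R n t"
  using assms by (cases "t = 0") (auto simp: log_trunc_0 log_trunc_eq)

lemma log_pos_SUP:
  assumes "R > 0" "t \<ge> 0"
  shows "log_pos R t = (SUP n. ennreal (log_trunc R n t))"
proof (cases "t = 0")
  case True
  then show ?thesis by (simp add: log_pos_def log_trunc_0 ennreal_SUP_of_nat_eq_top ennreal_of_nat_eq_real_of_nat [symmetric])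
next
  case False
  then have t: "t > 0" using assms by simp
  obtain n where n: "ln (R / t) \<le> real n" using real_arch_simple by blast
  show ?thesis
  proof (rule antisym)
    have eq: "log_pos R t = ennreal (log_trunc R n t)"
      using n t assms by (auto simp: log_pos_def log_trunc_eq max_def min_def ennreal_neg)
    then show "log_pos R t \<le> (SUP n. ennreal (log_trunc R n t))"
      unfolding eq by (intro SUP_upper) simp
    show "(SUP n. ennreal (log_trunc R n t)) \<le> log_pos R t"
      by (intro SUP_least log_trunc_le_log_pos assms)
  qed
qed

lemma log_pos_antimono:
  assumes "R > 0" "0 \<le> s" "s \<le> t"
  shows "log_pos R t \<le> log_pos R s"
  using assms by (cases "s = 0") (auto simp: log_pos_def intro!: ennreal_leI divide_left_mono)

text \<open>Concavity of \<open>ln\<close> makes \<open>ln (R / t)\<close> convex, and the positive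
  part taken by \<open>ennreal\<close> preserves convexity. At distance 0 the right-hand side is
  infinite because both weights are positive.\<close>

lemma log_pos_convex:
  assumes R: "R > 0" and s: "s \<ge> 0" "t \<ge> 0" and u: "0 < u" "u < 1"
  shows "log_pos R ((1 - u) * s + u * t) \<le> ennreal (1 - u) * log_pos R s + ennreal u * log_pos R t"
proof (cases "s = 0 \<or> t = 0")
  case True
  then show ?thesis using u by (auto simp: log_pos_def ennreal_mult_top)
next
  case False
  then have st: "s > 0" "t > 0" using s by auto
  define w where "w = (1 - u) * s + u * t"
  have w: "w > 0" unfolding w_def using st u by (intro add_pos_pos) auto
  have "(1 - u) * ln s + u * ln t \<le> ln w"
    using concave_onD[OF ln_concave, of u s t] st u by (simp add: w_def)
  then have "ln (R / w) \<le> (1 - u) * ln (R / s) + u * ln (R / t)"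
    using R st w by (simp add: ln_div algebra_simps)
  also have "\<dots> \<le> (1 - u) * max 0 (ln (R / s)) + u * max 0 (ln (R / t))"
    using u by (intro add_mono mult_left_mono) auto
  finally have "ennreal (ln (R / w)) \<le> ennreal ((1 - u) * max 0 (ln (R / s)) + u * max 0 (ln (R / t)))"
    by (rule ennreal_leI)
  also have "\<dots> = ennreal (1 - u) * ennreal (max 0 (ln (R / s))) + ennreal u * ennreal (max 0 (ln (R / t)))"
    using u by (simp add: ennreal_mult)
  also have "\<dots> = ennreal (1 - u) * log_pos R s + ennreal u * log_pos R t"
    using st by (simp add: log_pos_def ennreal_max_0 max.commute)
  finally show ?thesis using w by (simp add: log_pos_def w_def)
qed

section \<open>Potentials on the real line\<close>

definition log_pot :: "real \<Rightarrow> real measure \<Rightarrow> real \<Rightarrow> ennreal" where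
  "log_pot R nu x = (\<integral>\<^sup>+ y. log_pos R \<bar>x - y\<bar> \<partial>nu)"

definition trunc_pot :: "real \<Rightarrow> nat \<Rightarrow> real measure \<Rightarrow> real \<Rightarrow> real" where
  "trunc_pot R n nu x = (\<integral> y. log_trunc R n \<bar>x - y\<bar> \<partial>nu)"

text \<open>For a probability measure on a set of diameter at most \<open>R\<close> this is the
  logarithmic energy plus \<open>ln R\<close>; the shift makes the integrand nonnegative.\<close>

definition energy :: "real \<Rightarrow> real measure \<Rightarrow> ennreal" where
  "energy R nu = (\<integral>\<^sup>+ x. log_pot R nu x \<partial>nu)"

section \<open>Potentials of a probability measure and their truncations\<close>

context real_distribution begin

lemma integrable_log_trunc [simp]: "integrable M (\<lambda>y. log_trunc R n \<bar>x - y\<bar>)"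
  by (rule integrable_const_bound[where B = "real n"])
     (auto intro!: AE_I2 log_trunc_norm_le[simplified])

lemma trunc_pot_nonneg: "0 \<le> trunc_pot R n M x"
  unfolding trunc_pot_def by (simp add: log_trunc_nonneg)

lemma trunc_pot_le: "trunc_pot R n M x \<le> real n"
proof -
  have "trunc_pot R n M x \<le> (\<integral> y. real n \<partial>M)"
    unfolding trunc_pot_def by (intro integral_mono) (auto simp: log_trunc_le)
  then show ?thesis by (simp add: prob_space[simplified])
qed

lemma ennreal_trunc_pot: "ennreal (trunc_pot R n M x) = (\<integral>\<^sup>+ y. ennreal (log_trunc R n \<bar>x - y\<bar>) \<partial>M)"
  unfolding trunc_pot_def by (subst nn_integral_eq_integral) (auto simp: log_trunc_nonneg)

lemma trunc_pot_lipschitz: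
  assumes "R > 0"
  shows "\<bar>trunc_pot R n M x - trunc_pot R n M x'\<bar> \<le> exp (real n) / R * \<bar>x - x'\<bar>"
proof -
  have "\<bar>trunc_pot R n M x - trunc_pot R n M x'\<bar>
      = \<bar>\<integral> y. log_trunc R n \<bar>x - y\<bar> - log_trunc R n \<bar>x' - y\<bar> \<partial>M\<bar>"
    by (simp add: trunc_pot_def)
  also have "\<dots> \<le> (\<integral> y. \<bar>log_trunc R n \<bar>x - y\<bar> - log_trunc R n \<bar>x' - y\<bar>\<bar> \<partial>M)"
    by (rule integral_abs_bound)
  also have "\<dots> \<le> (\<integral> y. exp (real n) / R * \<bar>x - x'\<bar> \<partial>M)"
  proof (intro integral_mono)
    fix y
    have "\<bar>\<bar>x - y\<bar> - \<bar>x' - y\<bar>\<bar> \<le> \<bar>x - x'\<bar>" by linarith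
    then show "\<bar>log_trunc R n \<bar>x - y\<bar> - log_trunc R n \<bar>x' - y\<bar>\<bar> \<le> exp (real n) / R * \<bar>x - x'\<bar>"
      using log_trunc_lipschitz[OF assms, of n "\<bar>x - y\<bar>" "\<bar>x' - y\<bar>"] assms
      by (meson divide_nonneg_pos exp_ge_zero mult_left_mono order_trans)
  qed auto
  finally show ?thesis by (simp add: prob_space[simplified])
qed

lemma continuous_trunc_pot:
  assumes "R > 0"
  shows "continuous_on A (trunc_pot R n M)"
proof (rule lipschitz_on_continuous_on)
  show "(exp (real n) / R)-lipschitz_on A (trunc_pot R n M)"
    using assms trunc_pot_lipschitz[OF assms] by (auto simp: lipschitz_on_def dist_real_def)
qed

lemma log_pot_SUP:
  assumes "R > 0"
  shows "log_pot R M x = (SUP n. ennreal (trunc_pot R n M x))"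
  unfolding log_pot_def ennreal_trunc_pot
  by (subst nn_integral_monotone_convergence_SUP[symmetric])
     (auto simp: incseq_def le_fun_def assms log_pos_SUP intro!: ennreal_leI log_trunc_mono)

text \<open>Lower semicontinuity: the potential is a supremum of continuous truncated potentials.
  The bound becomes \<open>max 0 c\<close> since \<open>ennreal\<close> sends negative
  \<open>c\<close> to 0.\<close>

lemma closed_log_pot_le:
  assumes "R > 0"
  shows "closed {x. log_pot R M x \<le> ennreal c}"
proof -
  have *: "{x. log_pot R M x \<le> ennreal c} = (\<Inter>n. {x. trunc_pot R n M x \<le> max 0 c})"
    unfolding log_pot_SUP[OF assms] SUP_le_iff
    by (auto simp: trunc_pot_nonneg ennreal_le_iff2 le_max_iff_disj)
       (meson order_trans not_le_imp_less order_less_imp_le)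
  show ?thesis unfolding *
    by (intro closed_INT ballI closed_Collect_le continuous_trunc_pot assms continuous_intros)
qed

lemma log_pot_measurable [measurable]: "log_pot R M \<in> borel_measurable borel"
  unfolding log_pot_def by measurable

lemma log_pot_split:
  assumes "R > 0"
  shows "log_pot R M x = ennreal (trunc_pot R n M x) + log_pot (R * exp (- real n)) M x"
  unfolding log_pot_def ennreal_trunc_pot
  by (subst nn_integral_add[symmetric]) (auto simp: log_pos_split[OF assms, of _ n])

text \<open>Moving mass away from the set where the potential of a minimizer exceeds \<open>V\<close> would lower the
  energy to first order.\<close>
lemma log_pot_minimizer_AE:
  assumes R: "R > 0" and V: "V \<ge> 0" "energy R M = ennreal V"
    and min: "\<And>N. real_distribution N \<Longrightarrow> absolutely_continuous M N \<Longrightarrow> energy R M \<le> energy R N"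
  shows "AE x in M. log_pot R M x \<le> ennreal V"
proof -
  define S where "S = {x. log_pot R M x > ennreal V}"
  have S[measurable]: "S \<in> sets borel"
    unfolding S_def by measurable
  define G where "G x y = log_pos R \<bar>x - y\<bar>" for x y
  have G[measurable]: "(\<lambda>(x, y). G x y) \<in> borel_measurable (borel \<Otimes>\<^sub>M borel)"
    unfolding G_def by measurable
  define I :: "real set \<Rightarrow> real \<Rightarrow> ennreal" where "I A x = (if x \<in> A then 1 else 0)" for A x
  have I[measurable]: "I S \<in> borel_measurable borel" "I (- S) \<in> borel_measurable borel"
    unfolding I_def by measurable
  \<comment> \<open>The mutual energy of the parts of \<open>M\<close> on \<open>A\<close> and on
    \<open>B\<close>. By the symmetry \<open>sym\<close>, the energy of a density equal to
    \<open>p\<close> on \<open>S\<close> and \<open>q\<close> off \<open>S\<close> is a quadratic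
    form in \<open>p\<close> and \<open>q\<close>.\<close>
  define e where "e A B = (\<integral>\<^sup>+ x. I A x * (\<integral>\<^sup>+ y. I B y * G x y \<partial>M) \<partial>M)" for A B
  have I1: "I S x + I (- S) x = 1" for x by (simp add: I_def)
  have sym: "e (- S) S = e S (- S)"
  proof -
    have "e (- S) S = (\<integral>\<^sup>+ x. \<integral>\<^sup>+ y. I (- S) x * (I S y * G x y) \<partial>M \<partial>M)"
      unfolding e_def by (intro nn_integral_cong) (simp add: nn_integral_cmult)
    also have "\<dots> = (\<integral>\<^sup>+ y. \<integral>\<^sup>+ x. I (- S) x * (I S y * G x y) \<partial>M \<partial>M)"
    proof (rule pair_sigma_finite.Fubini')
      show "pair_sigma_finite M M" by standard
    qed measurable
    also have "\<dots> = (\<integral>\<^sup>+ y. \<integral>\<^sup>+ x. I S y * (I (- S) x * G y x) \<partial>M \<partial>M)"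
      by (intro nn_integral_cong) (simp add: G_def abs_minus_commute mult_ac)
    also have "\<dots> = e S (- S)"
      unfolding e_def by (intro nn_integral_cong) (simp add: nn_integral_cmult)
    finally show ?thesis .
  qed
  have en: "energy R (density M f) = ennreal (p\<^sup>2) * e S S + ennreal (2 * p * q) * e S (- S) + ennreal (q\<^sup>2) * e (- S) (- S)"
    if f: "f = (\<lambda>x. ennreal p * I S x + ennreal q * I (- S) x)" and pq: "p \<ge> 0" "q \<ge> 0" for f p q
  proof -
    have fm[measurable]: "f \<in> borel_measurable borel" unfolding f by measurable
    have 1: "log_pot R (density M f) x
        = ennreal p * (\<integral>\<^sup>+ y. I S y * G x y \<partial>M) + ennreal q * (\<integral>\<^sup>+ y. I (- S) y * G x y \<partial>M)" for x
    proof -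
      have "log_pot R (density M f) x = (\<integral>\<^sup>+ y. f y * G x y \<partial>M)"
        unfolding log_pot_def G_def by (subst nn_integral_density) auto
      also have "\<dots> = (\<integral>\<^sup>+ y. ennreal p * (I S y * G x y) + ennreal q * (I (- S) y * G x y) \<partial>M)"
        unfolding f by (intro nn_integral_cong) (simp add: algebra_simps)
      finally show ?thesis
        by (simp add: nn_integral_add nn_integral_cmult)
    qed
    have "energy R (density M f) = (\<integral>\<^sup>+ x. f x * log_pot R (density M f) x \<partial>M)"
      unfolding energy_def
    proof (rule nn_integral_density)
      show "log_pot R (density M f) \<in> borel_measurable M"
        unfolding 1[abs_def] by measurable
    qed measurable
    also have "\<dots> = (\<integral>\<^sup>+ x. ennreal p * ennreal p * (I S x * (\<integral>\<^sup>+ y. I S y * G x y \<partial>M))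
        + ennreal p * ennreal q * (I S x * (\<integral>\<^sup>+ y. I (- S) y * G x y \<partial>M))
        + ennreal p * ennreal q * (I (- S) x * (\<integral>\<^sup>+ y. I S y * G x y \<partial>M))
        + ennreal q * ennreal q * (I (- S) x * (\<integral>\<^sup>+ y. I (- S) y * G x y \<partial>M)) \<partial>M)"
      unfolding 1 unfolding f by (intro nn_integral_cong) (simp add: algebra_simps)
    also have "\<dots> = ennreal p * ennreal p * e S S + ennreal p * ennreal q * e S (- S)
       + ennreal p * ennreal q * e (- S) S + ennreal q * ennreal q * e (- S) (- S)"
      unfolding e_def by (simp add: nn_integral_add nn_integral_cmult)
    also have "\<dots> = ennreal p * ennreal p * e S S + 2 * (ennreal p * ennreal q) * e S (- S) + ennreal q * ennreal q * e (- S) (- S)"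
      unfolding sym mult_2 distrib_right by (simp add: add_ac)
    finally show ?thesis using pq by (simp add: ennreal_mult power2_eq_square mult_ac)
  qed
  have US: "log_pot R M x = (\<integral>\<^sup>+ y. I S y * G x y \<partial>M) + (\<integral>\<^sup>+ y. I (- S) y * G x y \<partial>M)" for x
    unfolding log_pot_def by (subst nn_integral_add[symmetric]) (auto simp: distrib_right[symmetric] I1 G_def)
  have "density M (\<lambda>x. ennreal 1 * I S x + ennreal 1 * I (- S) x) = density M (\<lambda>_. 1)"
    by (simp add: I1)
  then have tot: "e S S + 2 * e S (- S) + e (- S) (- S) = ennreal V"
    using en[OF refl, of 1 1] V by (simp add: density_1)
  obtain a b c where abc: "e S S = ennreal a" "e S (- S) = ennreal b" "e (- S) (- S) = ennreal c"
    "a \<ge> 0" "b \<ge> 0" "c \<ge> 0"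
  proof -
    have "e S S < \<top>" "e S (- S) < \<top>" "e (- S) (- S) < \<top>"
      using tot ennreal_less_top[of V] by (auto simp flip: tot simp: ennreal_mult_less_top mult_2)
    then show ?thesis using that
      by (auto simp: less_top_ennreal)
  qed
  have tot': "a + 2 * b + c = V"
  proof -
    have "ennreal (a + 2 * b + c) = ennreal V"
      using tot abc by (simp add: ennreal_mult)
    then show ?thesis using abc V by (subst (asm) ennreal_inj) auto
  qed
  define s where "s = prob S"
  have s: "0 \<le> s" "s \<le> 1" by (auto simp: s_def)
  have IS: "(\<integral>\<^sup>+ x. I S x \<partial>M) = ennreal s" "(\<integral>\<^sup>+ x. I (- S) x \<partial>M) = ennreal (1 - s)"
  proof -
    have "I A = indicator A" for A by (auto simp: I_def indicator_def)
    moreover have "prob (- S) = 1 - s" unfolding s_def by (subst prob_compl[symmetric]) (auto simp: Compl_eq_Diff_UNIV)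
    ultimately show "(\<integral>\<^sup>+ x. I S x \<partial>M) = ennreal s" "(\<integral>\<^sup>+ x. I (- S) x \<partial>M) = ennreal (1 - s)"
      by (auto simp: emeasure_eq_measure s_def)
  qed
  \<comment> \<open>Scaling \<open>M\<close> by \<open>1 - t * (1 - s)\<close> on \<open>S\<close>
    and by \<open>1 + t * s\<close> off \<open>S\<close> keeps the total mass 1 and changes the
    energy by \<open>t * (2 * D + t * K)\<close>. Here \<open>a + b\<close> is the integral of the
    potential over \<open>S\<close>.\<close>
  define D where "D = s * V - (a + b)"
  define K where "K = (1 - s)\<^sup>2 * a - 2 * s * (1 - s) * b + s\<^sup>2 * c"
  have var: "0 \<le> 2 * D + t * K" if t: "0 < t" "t \<le> 1" for t
  proof -
    define p where "p = 1 - t * (1 - s)"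
    define q where "q = 1 + t * s"
    have "t * (1 - s) \<le> 1 * 1" using t s by (intro mult_mono) auto
    then have p: "p \<ge> 0" by (simp add: p_def)
    have q: "q \<ge> 0" using t s by (simp add: q_def)
    define f where "f = (\<lambda>x. ennreal p * I S x + ennreal q * I (- S) x)"
    have fm[measurable]: "f \<in> borel_measurable borel" unfolding f_def by measurable
    have int1: "(\<integral>\<^sup>+ x. f x \<partial>M) = 1"
    proof -
      have "(\<integral>\<^sup>+ x. f x \<partial>M) = ennreal (p * s + q * (1 - s))"
        unfolding f_def using p q s by (simp add: nn_integral_add nn_integral_cmult IS ennreal_mult)
      also have "p * s + q * (1 - s) = 1" by (simp add: p_def q_def algebra_simps)
      finally show ?thesis by simp
    qed
    have "real_distribution (density M f)"
      unfolding real_distribution_def real_distribution_axioms_def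
      by (auto intro!: prob_spaceI simp: emeasure_density int1)
    moreover have "absolutely_continuous M (density M f)"
      by (rule absolutely_continuousI_density) measurable
    ultimately have "energy R M \<le> energy R (density M f)" by (rule min)
    then have "ennreal V \<le> ennreal (p\<^sup>2 * a + 2 * p * q * b + q\<^sup>2 * c)"
      unfolding V(2) en[OF f_def p q] abc using p q abc(4-) by (simp add: ennreal_mult[symmetric])
    then have "V \<le> p\<^sup>2 * a + 2 * p * q * b + q\<^sup>2 * c"
      using p q abc(4-) by (subst (asm) ennreal_le_iff) auto
    also have "\<dots> = V + t * (2 * D + t * K)"
      unfolding D_def K_def p_def q_def tot'[symmetric] by (simp add: algebra_simps power2_eq_square)
    finally show ?thesis using t by (simp add: zero_le_mult_iff)
  qed
  have D: "D \<ge> 0"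
  proof (rule ccontr)
    assume "\<not> D \<ge> 0"
    then have D0: "D < 0" by simp
    \<comment> \<open>Small enough for \<open>t * K\<close> to be at most \<open>- D\<close>, so
      that the first-order term wins and \<open>2 * D + t * K\<close> is negative.\<close>
    define t where "t = min 1 (- D / (\<bar>K\<bar> + 1))"
    have t: "0 < t" "t \<le> 1" using D0 by (auto simp: t_def intro!: divide_neg_pos)
    have "t * K \<le> t * (\<bar>K\<bar> + 1)" using t by (intro mult_left_mono) auto
    also have "\<dots> \<le> - D / (\<bar>K\<bar> + 1) * (\<bar>K\<bar> + 1)" by (intro mult_right_mono) (auto simp: t_def)
    also have "\<dots> = - D" by simp
    finally show False using var[OF t] D0 by simp
  qed
  have le: "(\<integral>\<^sup>+ x. I S x * log_pot R M x \<partial>M) \<le> ennreal (s * V)"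
  proof -
    have "(\<integral>\<^sup>+ x. I S x * log_pot R M x \<partial>M) = e S S + e S (- S)"
      unfolding US e_def by (subst nn_integral_add[symmetric]) (auto simp: distrib_left)
    also have "\<dots> \<le> ennreal (s * V)"
      using D abc by (simp add: D_def flip: ennreal_plus)
    finally show ?thesis .
  qed
  \<comment> \<open>On \<open>S\<close> the potential exceeds \<open>V\<close>, so its integral over
    \<open>S\<close> is \<open>s * V\<close> plus the integral of a positive excess. By
    \<open>le\<close> that excess integrates to 0, which makes \<open>S\<close> a null set.\<close>
  have "(\<integral>\<^sup>+ x. I S x * log_pot R M x \<partial>M)
      = (\<integral>\<^sup>+ x. I S x * (log_pot R M x - ennreal V) + ennreal V * I S x \<partial>M)"
    by (intro nn_integral_cong) (auto simp: I_def S_def diff_add_cancel_ennreal less_imp_le)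
  also have "\<dots> = (\<integral>\<^sup>+ x. I S x * (log_pot R M x - ennreal V) \<partial>M) + ennreal (s * V)"
    using s V by (simp add: nn_integral_add nn_integral_cmult IS ennreal_mult mult.commute)
  finally have "(\<integral>\<^sup>+ x. I S x * (log_pot R M x - ennreal V) \<partial>M) + ennreal (s * V) \<le> 0 + ennreal (s * V)"
    using le by simp
  then have "(\<integral>\<^sup>+ x. I S x * (log_pot R M x - ennreal V) \<partial>M) = 0"
    by (subst (asm) (1 2) add.commute, subst (asm) ennreal_add_left_cancel_le) auto
  then have "AE x in M. I S x * (log_pot R M x - ennreal V) = 0"
    by (subst (asm) nn_integral_0_iff_AE) auto
  then show ?thesis
    by eventually_elim (auto simp: I_def S_def dest: ennreal_minus_eq_0 split: if_splits)
qed

text \<open>The maximum principle is elementary on the line: on a gap of a closed set of full measure the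
  kernel is convex in \<open>x\<close>, or monotone if the gap is a half-line.\<close>
lemma log_pot_le_everywhere:
  assumes R: "R > 0" and AE: "AE x in M. log_pot R M x \<le> ennreal V"
  shows "log_pot R M x \<le> ennreal V"
proof (cases "log_pot R M x \<le> ennreal V")
  case False
  define F where "F = {x. log_pot R M x \<le> ennreal V}"
  have F: "closed F" unfolding F_def by (rule closed_log_pot_le[OF R])
  have AEF: "AE y in M. y \<in> F" using AE by (simp add: F_def)
  have xF: "x \<notin> F" using False by (simp add: F_def)
  have mono: "log_pot R M x \<le> ennreal V" if "z \<in> F" "AE y in M. \<bar>z - y\<bar> \<le> \<bar>x - y\<bar>" for z
  proof -
    have "log_pot R M x \<le> log_pot R M z"
      unfolding log_pot_def using that(2)
      by (intro nn_integral_mono_AE, eventually_elim) (rule log_pos_antimono[OF R], auto)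
    then show ?thesis using that(1) by (simp add: F_def)
  qed
  define L where "L = {y\<in>F. y \<le> x}"
  define U where "U = {y\<in>F. y \<ge> x}"
  have cl: "closed L" "closed U"
    using closed_Int[OF F closed_atMost[of x]] closed_Int[OF F closed_atLeast[of x]]
    by (auto simp: L_def U_def Int_def)
  have bd: "bdd_above L" "bdd_below U" by (auto simp: L_def U_def)
  \<comment> \<open>The ends of the gap of \<open>F\<close> around \<open>x\<close>, as far as they
    exist.\<close>
  define \<alpha> where "\<alpha> = Sup L"
  define \<beta> where "\<beta> = Inf U"
  have \<alpha>: "\<alpha> \<in> F" "\<alpha> < x" "\<And>y. y \<in> F \<Longrightarrow> y \<le> x \<Longrightarrow> y \<le> \<alpha>" if "L \<noteq> {}"
  proof -
    have "\<alpha> \<in> L" unfolding \<alpha>_def by (rule closed_contains_Sup) (use that cl bd in auto)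
    then show "\<alpha> \<in> F" "\<alpha> < x" using xF by (auto simp: L_def order.strict_iff_order)
    show "y \<le> \<alpha>" if "y \<in> F" "y \<le> x" for y
      unfolding \<alpha>_def using that bd by (intro cSup_upper) (auto simp: L_def)
  qed
  have \<beta>: "\<beta> \<in> F" "x < \<beta>" "\<And>y. y \<in> F \<Longrightarrow> y \<ge> x \<Longrightarrow> y \<ge> \<beta>" if "U \<noteq> {}"
  proof -
    have "\<beta> \<in> U" unfolding \<beta>_def by (rule closed_contains_Inf) (use that cl bd in auto)
    then show "\<beta> \<in> F" "x < \<beta>" using xF by (auto simp: U_def order.strict_iff_order)
    show "y \<ge> \<beta>" if "y \<in> F" "y \<ge> x" for y
      unfolding \<beta>_def using that bd by (intro cInf_lower) (auto simp: U_def)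
  qed
  consider "L \<noteq> {}" "U = {}" | "L = {}" "U \<noteq> {}" | "L = {}" "U = {}" | "L \<noteq> {}" "U \<noteq> {}" by blast
  then show ?thesis
  proof cases
    case 1
    show ?thesis
      by (rule mono[OF \<alpha>(1)[OF 1(1)]], use AEF in eventually_elim)
         (use 1 \<alpha>[OF 1(1)] in \<open>force simp: U_def\<close>)
  next
    case 2
    show ?thesis
      by (rule mono[OF \<beta>(1)[OF 2(2)]], use AEF in eventually_elim)
         (use 2 \<beta>[OF 2(2)] in \<open>force simp: L_def\<close>)
  next
    case 3
    have "AE y in M. False"
      using AEF by eventually_elim (use 3 linear in \<open>auto simp: L_def U_def\<close>)
    then show ?thesis by simp
  next
    case 4
    note \<alpha> = \<alpha>[OF 4(1)] and \<beta> = \<beta>[OF 4(2)]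
    define u where "u = (x - \<alpha>) / (\<beta> - \<alpha>)"
    have u: "0 < u" "u < 1" using \<alpha> \<beta> by (auto simp: u_def field_simps)
    have xu: "x = (1 - u) * \<alpha> + u * \<beta>"
    proof -
      have "u * (\<beta> - \<alpha>) = x - \<alpha>" using \<alpha> \<beta> by (simp add: u_def)
      then show ?thesis by (simp add: algebra_simps)
    qed
    have "log_pot R M x \<le> (\<integral>\<^sup>+ y. ennreal (1 - u) * log_pos R \<bar>\<alpha> - y\<bar> + ennreal u * log_pos R \<bar>\<beta> - y\<bar> \<partial>M)"
      unfolding log_pot_def
    proof (rule nn_integral_mono_AE, use AEF in eventually_elim)
      case (elim y)
      \<comment> \<open>A point \<open>y\<close> of \<open>F\<close> lies outside the gap, so the
        distance to \<open>y\<close> is affine between \<open>\<alpha>\<close> and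
        \<open>\<beta>\<close>.\<close>
      have "\<bar>x - y\<bar> = (1 - u) * \<bar>\<alpha> - y\<bar> + u * \<bar>\<beta> - y\<bar>"
      proof (cases "y \<le> x")
        case True
        then have "y \<le> \<alpha>" "y < \<beta>" using \<alpha> \<beta> elim by force+
        then show ?thesis using True by (simp add: xu algebra_simps)
      next
        case False
        then have "y \<ge> \<beta>" "y > \<alpha>" using \<alpha> \<beta> elim by force+
        then show ?thesis using False by (simp add: xu algebra_simps)
      qed
      then show ?case using log_pos_convex[OF R _ _ u, of "\<bar>\<alpha> - y\<bar>" "\<bar>\<beta> - y\<bar>"] by simp
    qed
    also have "\<dots> = ennreal (1 - u) * log_pot R M \<alpha> + ennreal u * log_pot R M \<beta>"
      unfolding log_pot_def by (simp add: nn_integral_add nn_integral_cmult)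
    also have "\<dots> \<le> ennreal (1 - u) * ennreal V + ennreal u * ennreal V"
      using \<alpha>(1) \<beta>(1) by (intro add_mono mult_left_mono) (auto simp: F_def)
    also have "\<dots> = ennreal V"
      using u by (simp add: distrib_right[symmetric] flip: ennreal_plus)
    finally show ?thesis .
  qed
qed

section \<open>Uniform truncation of potentials of finite energy\<close>

text \<open>The truncated potentials increase to the potential. If every tail exceeded
  \<open>e\<close>, their supremum plus \<open>e\<close> would still be at most the potential, which
  is impossible for a finite value.\<close>

lemma log_pot_truncation_tail:
  assumes R: "R > 0" and fin: "log_pot R M x < \<infinity>" and e: "e > 0"
  shows "\<exists>m. log_pot (R * exp (- real m)) M x \<le> ennreal e"
proof (rule ccontr)
  assume "\<nexists>m. log_pot (R * exp (- real m)) M x \<le> ennreal e"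
  then have *: "ennreal (trunc_pot R m M x) + ennreal e \<le> log_pot R M x" for m
    unfolding log_pot_split[OF R, of x m] by (intro add_left_mono) (auto simp: not_le intro: less_imp_le)
  have "log_pot R M x + ennreal e = (SUP m. ennreal (trunc_pot R m M x) + ennreal e)"
    unfolding log_pot_SUP[OF R] by (subst ennreal_SUP_add_left) auto
  also have "\<dots> \<le> log_pot R M x" by (intro SUP_least *)
  finally have "log_pot R M x + ennreal e \<le> log_pot R M x + 0" by simp
  then have "ennreal e \<le> 0" using fin by (subst (asm) ennreal_add_left_cancel_le) auto
  then show False using e by simp
qed

lemma log_pot_tail_mono:
  assumes "R > 0" "m \<le> n"
  shows "log_pot (R * exp (- real n)) M x \<le> log_pot (R * exp (- real m)) M x"
  unfolding log_pot_def
proof (intro nn_integral_mono)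
  fix y
  show "log_pos (R * exp (- real n)) \<bar>x - y\<bar> \<le> log_pos (R * exp (- real m)) \<bar>x - y\<bar>"
    using assms by (auto simp: log_pos_def intro!: ennreal_leI divide_right_mono mult_left_mono)
qed

text \<open>An Egorov argument: the tail potentials decrease to 0 almost everywhere, so they
  do so uniformly on a closed set \<open>S\<close> of positive measure. Off \<open>S\<close> the tail is at most the sum
  of the tails at the two points of \<open>S\<close> adjacent to \<open>x\<close>.\<close>
lemma uniform_truncation:
  assumes R: "R > 0" and fin: "energy R M < \<infinity>"
  obtains S where "S \<in> sets borel" "emeasure M S \<noteq> 0"
    "\<And>e. e > 0 \<Longrightarrow> \<exists>m. \<forall>x. log_pot R (uniform_measure M S) x
        \<le> ennreal (trunc_pot R m (uniform_measure M S) x + e)"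
proof -
  define A where "A k m = {x. log_pot (R * exp (- real m)) M x \<le> ennreal (1 / (real k + 1))}" for k m
  have clA: "closed (A k m)" for k m
    unfolding A_def using R by (intro closed_log_pot_le) auto
  then have Am[measurable]: "A k m \<in> sets borel" for k m by simp
  have AEfin: "AE x in M. log_pot R M x < \<infinity>"
    using nn_integral_PInf_AE[of "log_pot R M" M] fin by (auto simp: energy_def less_top)
  have lim: "(\<lambda>m. prob (A k m)) \<longlonglongrightarrow> 1" for k
  proof -
    have "(\<lambda>m. prob (A k m)) \<longlonglongrightarrow> prob (\<Union>m. A k m)"
      using log_pot_tail_mono[OF R] by (intro finite_Lim_measure_incseq)
         (auto simp: incseq_def A_def intro: order_trans)
    also have "prob (\<Union>m. A k m) = 1"
    proof (subst prob_eq_1)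
      show "AE x in M. x \<in> (\<Union>m. A k m)"
        using AEfin by eventually_elim (auto simp: A_def intro!: log_pot_truncation_tail R)
    qed auto
    finally show ?thesis .
  qed
  have "\<exists>m. prob (A k m) > 1 - (1/2)^(k+2)" for k
  proof -
    have "\<forall>\<^sub>F m in sequentially. prob (A k m) > 1 - (1/2)^(k+2)"
      by (rule order_tendstoD(1)[OF lim]) simp
    then show ?thesis by (auto simp: eventually_sequentially)
  qed
  then obtain m where m: "\<And>k. prob (A k (m k)) > 1 - (1/2)^(k+2)" by metis
  \<comment> \<open>The complements of the sets \<open>A k (m k)\<close> have measure below
    \<open>(1/2)^(k+2)\<close>, and these bounds sum to 1/2. So \<open>S\<close> keeps at least half
    of the mass while all the tail bounds hold on it at once.\<close>
  define S where "S = (\<Inter>k. A k (m k))"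
  have clS: "closed S" unfolding S_def using clA by blast
  then have Sm[measurable]: "S \<in> sets borel" by simp
  have compl: "prob (- A k (m k)) \<le> (1/2)^2 * (1/2)^k" for k
  proof -
    have "prob (- A k (m k)) = 1 - prob (A k (m k))"
      using prob_compl[of "A k (m k)"] by (simp add: Compl_eq_Diff_UNIV)
    then show ?thesis using m[of k] by (simp add: power_add power2_eq_square)
  qed
  have geom: "summable (\<lambda>k. (1/2)^2 * (1/2 :: real)^k)"
    by (intro summable_mult summable_geometric) auto
  have sm: "summable (\<lambda>k. prob (- A k (m k)))"
    by (rule summable_comparison_test'[OF geom]) (use compl in auto)
  have "prob (- S) \<le> (\<Sum>k. prob (- A k (m k)))"
    unfolding S_def Compl_INT
    by (rule finite_measure_subadditive_countably) (use sm in auto)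
  also have "\<dots> \<le> (\<Sum>k. (1/2)^2 * (1/2)^k)"
    by (rule suminf_le[OF compl sm geom])
  also have "\<dots> = 1/2" by (subst suminf_mult) (auto simp: suminf_geometric power2_eq_square)
  finally have Sc: "prob (- S) \<le> 1/2" .
  then have Sh: "prob S \<ge> 1/2"
    using prob_compl[of S] by (simp add: Compl_eq_Diff_UNIV)
  have S0: "emeasure M S \<noteq> 0" using Sh by (auto simp: emeasure_eq_measure)
  have Sne: "S \<noteq> {}" using S0 by auto
  define N where "N = uniform_measure M S"
  interpret N: real_distribution N
    unfolding real_distribution_def real_distribution_axioms_def N_def
    using S0 by (auto intro!: prob_space_uniform_measure)
  have NS: "log_pot r N x = (\<integral>\<^sup>+ y. log_pos r \<bar>x - y\<bar> * indicator S y \<partial>M) / emeasure M S" for r x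
    unfolding log_pot_def N_def by (subst nn_integral_uniform_measure) (use S0 in auto)
  \<comment> \<open>Conditioning on \<open>S\<close> at most doubles integrals, because
    \<open>S\<close> has probability at least 1/2.\<close>
  have half: "a / emeasure M S \<le> 2 * a" for a :: ennreal
  proof -
    have "inverse (emeasure M S) = ennreal (inverse (prob S))"
      unfolding emeasure_eq_measure using Sh by (intro inverse_ennreal) simp
    also have "\<dots> \<le> ennreal 2"
      using Sh by (intro ennreal_leI) (simp add: field_simps)
    also have "\<dots> = 2" by simp
    finally show ?thesis unfolding divide_ennreal_def by (metis mult.commute mult_left_mono zero_le)
  qed
  have onS: "log_pot (R * exp (- real (m k))) N x \<le> ennreal (2 / (real k + 1))" if "x \<in> S" for x k
  proof -
    have "log_pot (R * exp (- real (m k))) N x \<le> 2 * (\<integral>\<^sup>+ y. log_pos (R * exp (- real (m k))) \<bar>x - y\<bar> * indicator S y \<partial>M)"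
      unfolding NS by (rule half)
    also have "\<dots> \<le> 2 * log_pot (R * exp (- real (m k))) M x"
      unfolding log_pot_def by (intro mult_left_mono nn_integral_mono) (auto simp: indicator_def)
    also have "\<dots> \<le> 2 * ennreal (1 / (real k + 1))"
      using that by (intro mult_left_mono) (auto simp: S_def A_def)
    also have "\<dots> = ennreal (2 * (1 / (real k + 1)))"
      by (subst ennreal_mult) auto
    finally show ?thesis by simp
  qed
  have AENS: "AE y in N. y \<in> S" unfolding N_def by (rule AE_uniform_measureI) auto
  \<comment> \<open>The two points are the nearest points of \<open>S\<close> on the left and on the
    right of \<open>x\<close>. If one side contains no point of \<open>S\<close>, the condition
    there is vacuous and any point of \<open>S\<close> serves.\<close>
  have near: "\<exists>s1\<in>S. \<exists>s2\<in>S. \<forall>y\<in>S. \<bar>s1 - y\<bar> \<le> \<bar>x - y\<bar> \<or> \<bar>s2 - y\<bar> \<le> \<bar>x - y\<bar>" for x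
  proof -
    have 1: "\<exists>s1\<in>S. \<forall>y\<in>S. y \<le> x \<longrightarrow> \<bar>s1 - y\<bar> \<le> \<bar>x - y\<bar>"
    proof (cases "{y\<in>S. y \<le> x} = {}")
      case False
      have b: "bdd_above {y\<in>S. y \<le> x}" by auto
      have "closed {y\<in>S. y \<le> x}" using closed_Int[OF clS closed_atMost[of x]] by (auto simp: Int_def)
      then have "Sup {y\<in>S. y \<le> x} \<in> {y\<in>S. y \<le> x}"
        by (intro closed_contains_Sup False b)
      moreover have "y \<le> Sup {y\<in>S. y \<le> x}" if "y \<in> S" "y \<le> x" for y
        using that b by (intro cSup_upper) auto
      ultimately show ?thesis by (intro bexI[of _ "Sup {y\<in>S. y \<le> x}"]) fastforce+
    qed (use Sne in auto)
    have 2: "\<exists>s1\<in>S. \<forall>y\<in>S. y \<ge> x \<longrightarrow> \<bar>s1 - y\<bar> \<le> \<bar>x - y\<bar>"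
    proof (cases "{y\<in>S. y \<ge> x} = {}")
      case False
      have b: "bdd_below {y\<in>S. y \<ge> x}" by auto
      have "closed {y\<in>S. y \<ge> x}" using closed_Int[OF clS closed_atLeast[of x]] by (auto simp: Int_def)
      then have "Inf {y\<in>S. y \<ge> x} \<in> {y\<in>S. y \<ge> x}"
        by (intro closed_contains_Inf False b)
      moreover have "y \<ge> Inf {y\<in>S. y \<ge> x}" if "y \<in> S" "y \<ge> x" for y
        using that b by (intro cInf_lower) auto
      ultimately show ?thesis by (intro bexI[of _ "Inf {y\<in>S. y \<ge> x}"]) fastforce+
    qed (use Sne in auto)
    from 1 2 show ?thesis using linear by metis
  qed
  have tail: "log_pot (R * exp (- real (m k))) N x \<le> ennreal (4 / (real k + 1))" for x k
  proof -
    obtain s1 s2 where s: "s1 \<in> S" "s2 \<in> S" "\<And>y. y \<in> S \<Longrightarrow> \<bar>s1 - y\<bar> \<le> \<bar>x - y\<bar> \<or> \<bar>s2 - y\<bar> \<le> \<bar>x - y\<bar>"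
      using near[of x] by blast
    define r where "r = R * exp (- real (m k))"
    have r: "r > 0" using R by (simp add: r_def)
    have "log_pot r N x \<le> (\<integral>\<^sup>+ y. log_pos r \<bar>s1 - y\<bar> + log_pos r \<bar>s2 - y\<bar> \<partial>N)"
      unfolding log_pot_def
    proof (rule nn_integral_mono_AE, use AENS in eventually_elim)
      case (elim y)
      from s(3)[OF this] show ?case
        using log_pos_antimono[OF r, of "\<bar>s1 - y\<bar>" "\<bar>x - y\<bar>"] log_pos_antimono[OF r, of "\<bar>s2 - y\<bar>" "\<bar>x - y\<bar>"]
        by (auto intro: order_trans add_increasing add_increasing2)
    qed
    also have "\<dots> = log_pot r N s1 + log_pot r N s2"
      unfolding log_pot_def by (simp add: nn_integral_add)
    also have "\<dots> \<le> ennreal (2 / (real k + 1)) + ennreal (2 / (real k + 1))"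
      using s onS unfolding r_def by (intro add_mono) auto
    also have "\<dots> = ennreal (4 / (real k + 1))"
      by (subst ennreal_plus[symmetric]) (auto simp: add_divide_distrib[symmetric])
    finally show ?thesis by (simp add: r_def)
  qed
  have "\<exists>m. \<forall>x. log_pot R N x \<le> ennreal (trunc_pot R m N x + e)" if e: "e > 0" for e
  proof -
    obtain k where k: "4 / e \<le> real k" using real_arch_simple by blast
    have "4 / e \<le> real k + 1" using k by simp
    then have ke: "4 / (real k + 1) \<le> e" using e by (simp add: field_simps)
    show ?thesis
    proof (intro exI[of _ "m k"] allI)
      fix x
      have "log_pot R N x \<le> ennreal (trunc_pot R (m k) N x) + ennreal e"
        unfolding N.log_pot_split[OF R, of x "m k"] using ke
        by (intro add_left_mono order_trans[OF tail] ennreal_leI)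
      then show "log_pot R N x \<le> ennreal (trunc_pot R (m k) N x + e)"
        using e N.trunc_pot_nonneg by simp
    qed
  qed
  then show ?thesis using that[of S] S0 by (simp add: N_def)
qed

end

section \<open>Limits of empirical measures\<close>

lemma trunc_pot_weak_conv:
  assumes nu: "\<And>k. real_distribution (nu k)" and M: "real_distribution M"
    and conv: "weak_conv_m nu M" and R: "R > 0"
  shows "(\<lambda>k. trunc_pot R m (nu k) x) \<longlonglongrightarrow> trunc_pot R m M x"
  unfolding trunc_pot_def
proof (rule weak_conv_imp_integral_bdd_continuous_conv[OF nu M conv])
  show "isCont (\<lambda>y. log_trunc R m \<bar>x - y\<bar>) y" for y
    using continuous_on_compose2[OF continuous_log_trunc[of UNIV R m], of UNIV "\<lambda>y. \<bar>x - y\<bar>"]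
    by (auto intro!: continuous_intros simp: continuous_on_eq_continuous_at)
  show "norm (log_trunc R m \<bar>x - y\<bar>) \<le> real m" for y
    by (rule log_trunc_norm_le)
qed

text \<open>Measure and integrand vary together. The truncated potentials share one Lipschitz
  constant, so their pointwise convergence is uniform on the compact set \<open>E\<close>; the limit
  potential is then a fixed continuous test function.\<close>

lemma trunc_energy_weak_conv:
  assumes nu: "\<And>k. real_distribution (nu k)" and M: "real_distribution M"
    and conv: "weak_conv_m nu M" and R: "R > 0"
    and E: "compact E" "\<And>k. AE x in nu k. x \<in> E"
  shows "(\<lambda>k. \<integral>x. trunc_pot R m (nu k) x \<partial>nu k) \<longlonglongrightarrow> (\<integral>x. trunc_pot R m M x \<partial>M)"
proof -
  interpret M: real_distribution M by (rule M)
  note [simp] = real_distribution.events_eq_borel[OF nu]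
  have g: "(\<lambda>k. \<integral>x. trunc_pot R m M x \<partial>nu k) \<longlonglongrightarrow> (\<integral>x. trunc_pot R m M x \<partial>M)"
  proof (rule weak_conv_imp_integral_bdd_continuous_conv[OF nu M conv])
    show "isCont (trunc_pot R m M) y" for y
      using M.continuous_trunc_pot[OF R, of UNIV m] by (auto simp: continuous_on_eq_continuous_at)
    show "norm (trunc_pot R m M y) \<le> real m" for y
      using M.trunc_pot_nonneg[of R m y] M.trunc_pot_le[of R m y] by simp
  qed
  have "(\<lambda>k. (\<integral>x. trunc_pot R m (nu k) x \<partial>nu k) - (\<integral>x. trunc_pot R m M x \<partial>nu k)) \<longlonglongrightarrow> 0"
  proof (rule tendstoI)
    fix e :: real assume e: "e > 0"
    define L where "L = exp (real m) / R"
    have L: "L > 0" using R by (simp add: L_def)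
    \<comment> \<open>Moving from \<open>x\<close> to a net point within \<open>d\<close> costs at
      most \<open>e / 4\<close> for each of the two potentials, and their difference at the net
      point is below \<open>e / 4\<close>.\<close>
    define d where "d = e / (4 * L)"
    have d: "d > 0" using e L by (simp add: d_def)
    obtain F where F: "finite F" "F \<subseteq> E" "E \<subseteq> (\<Union>z\<in>F. ball z d)"
      using compactE_image[OF E(1), of E "\<lambda>z. ball z d"] d by (metis UN_I centre_in_ball open_ball subsetI)
    have "\<forall>\<^sub>F k in sequentially. \<forall>z\<in>F. dist (trunc_pot R m (nu k) z) (trunc_pot R m M z) < e / 4"
      using e by (intro eventually_ball_finite F ballI tendstoD[OF trunc_pot_weak_conv[OF nu M conv R]]) auto
    then show "\<forall>\<^sub>F k in sequentially. dist ((\<integral>x. trunc_pot R m (nu k) x \<partial>nu k) - (\<integral>x. trunc_pot R m M x \<partial>nu k)) 0 < e"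
    proof eventually_elim
      case (elim k)
      interpret N: real_distribution "nu k" by (rule nu)
      have m1[measurable]: "trunc_pot R m (nu k) \<in> borel_measurable borel" "trunc_pot R m M \<in> borel_measurable borel"
        by (intro borel_measurable_continuous_onI N.continuous_trunc_pot M.continuous_trunc_pot R)+
      have i1: "integrable (nu k) (trunc_pot R m (nu k))"
        by (rule N.integrable_const_bound[where B = m])
           (auto intro!: AE_I2 simp: N.trunc_pot_nonneg N.trunc_pot_le)
      have i2: "integrable (nu k) (trunc_pot R m M)"
        by (rule N.integrable_const_bound[where B = m])
           (auto intro!: AE_I2 simp: M.trunc_pot_nonneg M.trunc_pot_le)
      have pt: "\<bar>trunc_pot R m (nu k) x - trunc_pot R m M x\<bar> \<le> 3 * e / 4" if "x \<in> E" for x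
      proof -
        from that F obtain z where z: "z \<in> F" "\<bar>x - z\<bar> < d" by (auto simp: dist_real_def abs_minus_commute)
        have Ld: "L * \<bar>x - z\<bar> \<le> e / 4"
        proof -
          have "L * \<bar>x - z\<bar> \<le> L * d" using z L by (intro mult_left_mono) auto
          then show ?thesis using L by (simp add: d_def)
        qed
        have "\<bar>trunc_pot R m (nu k) x - trunc_pot R m (nu k) z\<bar> \<le> L * \<bar>x - z\<bar>"
          "\<bar>trunc_pot R m M x - trunc_pot R m M z\<bar> \<le> L * \<bar>x - z\<bar>"
          unfolding L_def by (intro N.trunc_pot_lipschitz M.trunc_pot_lipschitz R)+
        moreover have "\<bar>trunc_pot R m (nu k) z - trunc_pot R m M z\<bar> < e / 4"
          using elim z by (auto simp: dist_real_def)
        ultimately show ?thesis using Ld by linarith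
      qed
      have "\<bar>(\<integral>x. trunc_pot R m (nu k) x \<partial>nu k) - (\<integral>x. trunc_pot R m M x \<partial>nu k)\<bar>
          = \<bar>\<integral>x. trunc_pot R m (nu k) x - trunc_pot R m M x \<partial>nu k\<bar>"
        using i1 i2 by simp
      also have "\<dots> \<le> (\<integral>x. \<bar>trunc_pot R m (nu k) x - trunc_pot R m M x\<bar> \<partial>nu k)"
        by (rule integral_abs_bound)
      also have "\<dots> \<le> (\<integral>x. 3 * e / 4 \<partial>nu k)"
      proof (rule integral_mono_AE)
        show "AE x in nu k. \<bar>trunc_pot R m (nu k) x - trunc_pot R m M x\<bar> \<le> 3 * e / 4"
          using E(2)[of k] by eventually_elim (rule pt)
      qed (use i1 i2 in auto)
      also have "\<dots> < e" using e by (simp add: N.prob_space[simplified])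
      finally show ?case by (simp add: dist_real_def)
    qed
  qed
  from tendsto_add[OF this g] show ?thesis by simp
qed

text \<open>The test function \<open>min 1 (infdist x E)\<close> is bounded, continuous and zero
  exactly on \<open>E\<close>, so its integral vanishes along the sequence and hence in the
  limit.\<close>

lemma weak_conv_AE_closed:
  assumes nu: "\<And>k. real_distribution (nu k)" and M: "real_distribution M"
    and conv: "weak_conv_m nu M"
    and E: "closed E" "\<And>k. AE x in nu k. x \<in> E" "E \<noteq> {}"
  shows "AE x in M. x \<in> E"
proof -
  interpret M: real_distribution M by (rule M)
  define f where "f x = min 1 (infdist x E)" for x :: real
  have fc: "continuous_on UNIV f" unfolding f_def by (intro continuous_intros)
  have [measurable]: "f \<in> borel_measurable borel" using fc by (rule borel_measurable_continuous_onI)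
  have f: "0 \<le> f x" "f x \<le> 1" for x by (auto simp: f_def infdist_nonneg)
  have "(\<lambda>k. \<integral>x. f x \<partial>nu k) \<longlonglongrightarrow> (\<integral>x. f x \<partial>M)"
    by (rule weak_conv_imp_integral_bdd_continuous_conv[OF nu M conv, where B = 1])
       (use fc f in \<open>auto simp: continuous_on_eq_continuous_at\<close>)
  moreover have "(\<integral>x. f x \<partial>nu k) = 0" for k
    by (rule integral_eq_zero_AE) (use E(2)[of k] in eventually_elim, simp add: f_def)
  ultimately have "(\<integral>x. f x \<partial>M) = 0" by (simp add: LIMSEQ_const_iff)
  moreover have "integrable M f"
    by (rule M.integrable_const_bound[where B = 1]) (auto intro!: AE_I2 simp: f)
  ultimately have "AE x in M. f x = 0" by (subst (asm) integral_nonneg_eq_0_iff_AE) (auto simp: f)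
  then show ?thesis
    by eventually_elim (use E in \<open>auto simp: f_def in_closed_iff_infdist_zero min_def split: if_splits\<close>)
qed

lemma (in real_distribution) energy_le_of_trunc_energy_le:
  assumes R: "R > 0" and le: "\<And>m. (\<integral>x. trunc_pot R m M x \<partial>M) \<le> W"
  shows "energy R M \<le> ennreal W"
proof -
  have m[measurable]: "trunc_pot R m M \<in> borel_measurable borel" for m
    by (intro borel_measurable_continuous_onI continuous_trunc_pot R)
  have "energy R M = (\<integral>\<^sup>+x. (SUP m. ennreal (trunc_pot R m M x)) \<partial>M)"
    unfolding energy_def log_pot_SUP[OF R, abs_def] ..
  also have "\<dots> = (SUP m. \<integral>\<^sup>+x. ennreal (trunc_pot R m M x) \<partial>M)"
  proof (rule nn_integral_monotone_convergence_SUP)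
    show "incseq (\<lambda>m x. ennreal (trunc_pot R m M x))"
      unfolding trunc_pot_def incseq_def le_fun_def
      by (auto intro!: ennreal_leI integral_mono log_trunc_mono R)
  qed measurable
  also have "\<dots> \<le> ennreal W"
  proof (rule SUP_least)
    fix m
    have "(\<integral>\<^sup>+x. ennreal (trunc_pot R m M x) \<partial>M) = ennreal (\<integral>x. trunc_pot R m M x \<partial>M)"
    proof (rule nn_integral_eq_integral)
      show "integrable M (trunc_pot R m M)"
        by (rule integrable_const_bound[where B = m])
           (auto intro!: AE_I2 simp: trunc_pot_nonneg trunc_pot_le)
    qed (auto simp: trunc_pot_nonneg)
    also have "\<dots> \<le> ennreal W" by (intro ennreal_leI le)
    finally show "(\<integral>\<^sup>+x. ennreal (trunc_pot R m M x) \<partial>M) \<le> ennreal W" .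
  qed
  finally show ?thesis .
qed

section \<open>Greedy points and their empirical measures\<close>

text \<open>The index set \<open>{..n}\<close> has \<open>n + 1\<close> elements, whence the weight
  \<open>1 / (n + 1)\<close>. Repeated points add up their weights.\<close>

definition empirical :: "(nat \<Rightarrow> real) \<Rightarrow> nat \<Rightarrow> real measure" where
  "empirical x n = distr (measure_pmf (pmf_of_set {..n})) borel x"

lemma real_distribution_empirical: "real_distribution (empirical x n)"
  unfolding real_distribution_def real_distribution_axioms_def empirical_def
  by (auto intro!: measure_pmf.prob_space_distr)

lemma AE_empirical: "(\<And>i. x i \<in> E) \<Longrightarrow> E \<in> sets borel \<Longrightarrow> AE z in empirical x n. z \<in> E"
  unfolding empirical_def by (subst AE_distr_iff) auto

lemma integral_empirical:
  fixes f :: "real \<Rightarrow> real"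
  assumes "f \<in> borel_measurable borel"
  shows "(\<integral>z. f z \<partial>empirical x n) = (\<Sum>i\<le>n. f (x i)) / (real n + 1)"
  unfolding empirical_def using assms
  by (subst integral_distr) (auto simp: integral_pmf_of_set)

lemma trunc_energy_empirical:
  assumes "R > 0"
  shows "(\<integral>z. trunc_pot R m (empirical x n) z \<partial>empirical x n)
     = (\<Sum>i\<le>n. \<Sum>j\<le>n. log_trunc R m \<bar>x i - x j\<bar>) / (real n + 1)\<^sup>2"
proof -
  interpret real_distribution "empirical x n" by (rule real_distribution_empirical)
  have [measurable]: "trunc_pot R m (empirical x n) \<in> borel_measurable borel"
    by (intro borel_measurable_continuous_onI continuous_trunc_pot assms)
  have "trunc_pot R m (empirical x n) z = (\<Sum>j\<le>n. log_trunc R m \<bar>z - x j\<bar>) / (real n + 1)" for z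
    unfolding trunc_pot_def by (subst integral_empirical) auto
  then show ?thesis
    by (subst integral_empirical) (auto simp: sum_divide_distrib power2_eq_square)
qed

text \<open>If no polynomial with zeros in \<open>E\<close> were small on \<open>E\<close>, points of \<open>E\<close> could be picked greedily
  so that the weak limit of their empirical measures has energy at most \<open>V - e\<close>.\<close>
lemma small_polynomial_on_compact:
  fixes E :: "real set"
  assumes E: "compact E" "E \<noteq> {}" and R: "R > 0" "\<And>x y. x \<in> E \<Longrightarrow> y \<in> E \<Longrightarrow> \<bar>x - y\<bar> \<le> R"
    and V: "\<And>N. real_distribution N \<Longrightarrow> AE x in N. x \<in> E \<Longrightarrow> ennreal V \<le> energy R N"
    and e: "e > 0"
  shows "\<exists>k\<ge>1. \<exists>xs :: nat \<Rightarrow> real. \<forall>x\<in>E. (\<Prod>i<k. \<bar>x - xs i\<bar>) \<le> (R * exp (- (V - e))) ^ k"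
proof (rule ccontr)
  assume "\<not> ?thesis"
  then have no: "\<exists>x\<in>E. (\<Prod>i<k. \<bar>x - xs i\<bar>) > (R * exp (- (V - e))) ^ k" if "k \<ge> 1" for k :: nat and xs
    using that by (metis not_less)
  define W where "W = V - e"
  define q where "q = R * exp (- W)"
  have q: "q > 0" using R by (simp add: q_def)
  \<comment> \<open>The point \<open>x k\<close> is chosen where the monic polynomial with zeros
    \<open>x 0\<close>, ..., \<open>x (k - 1)\<close> exceeds \<open>q ^ k\<close>, which
    \<open>no\<close> permits. For \<open>k = 0\<close> both sides would be 1, so the strict
    inequality is asked only from \<open>k = 1\<close> on.\<close>
  have "\<exists>x. \<forall>k. x k \<in> E \<and> (k \<ge> 1 \<longrightarrow> (\<Prod>i<k. \<bar>x k - x i\<bar>) > q ^ k)"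
  proof (rule dependent_wellorder_choice)
    fix k :: nat and x :: "nat \<Rightarrow> real"
    show "\<exists>r. r \<in> E \<and> (k \<ge> 1 \<longrightarrow> (\<Prod>i<k. \<bar>r - x i\<bar>) > q ^ k)"
      using no[of k x] E(2) by (cases "k \<ge> 1") (auto simp: q_def W_def)
  qed auto
  then obtain x where x: "\<And>k. x k \<in> E" "\<And>k. k \<ge> 1 \<Longrightarrow> (\<Prod>i<k. \<bar>x k - x i\<bar>) > q ^ k" by blast
  \<comment> \<open>The logarithm of the greedy inequality. Since points of \<open>E\<close> are at
    most \<open>R\<close> apart, \<open>ln (R / t)\<close> is nonnegative at their distances, and
    the truncated kernel lies below it.\<close>
  have row: "(\<Sum>i<k. log_trunc R m \<bar>x k - x i\<bar>) \<le> real k * W" if k: "k \<ge> 1" for k m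
  proof -
    have pos: "\<bar>x k - x i\<bar> > 0" if "i < k" for i
    proof (rule ccontr)
      assume "\<not> \<bar>x k - x i\<bar> > 0"
      then have "(\<Prod>i<k. \<bar>x k - x i\<bar>) = 0" using that by (intro prod_zero) auto
      then show False using x(2)[OF k] zero_less_power[OF q, of k] by linarith
    qed
    have "(\<Sum>i<k. log_trunc R m \<bar>x k - x i\<bar>) \<le> (\<Sum>i<k. ln R - ln \<bar>x k - x i\<bar>)"
    proof (rule sum_mono)
      fix i assume i: "i \<in> {..<k}"
      then have p: "\<bar>x k - x i\<bar> > 0" using pos by simp
      have "0 \<le> ln (R / \<bar>x k - x i\<bar>)" using p R(2)[OF x(1) x(1)] by simp
      moreover have "ln (R / \<bar>x k - x i\<bar>) = ln R - ln \<bar>x k - x i\<bar>" using p R by (simp add: ln_div)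
      ultimately show "log_trunc R m \<bar>x k - x i\<bar> \<le> ln R - ln \<bar>x k - x i\<bar>"
        using log_trunc_eq[OF R(1) p, of m] by simp
    qed
    also have "\<dots> = real k * ln R - ln (\<Prod>i<k. \<bar>x k - x i\<bar>)"
      using pos by (subst ln_prod) (auto simp: sum_subtractf)
    also have "\<dots> \<le> real k * ln R - ln (q ^ k)"
      using x(2)[OF k] zero_less_power[OF q, of k]
      by (intro diff_left_mono, subst ln_le_cancel_iff) linarith+
    also have "\<dots> = real k * W"
      using q R by (simp add: ln_realpow q_def ln_mult algebra_simps)
    finally show ?thesis .
  qed
  \<comment> \<open>Nonnegativity of \<open>W\<close> serves the induction below and ensures that
    \<open>ennreal W\<close> is not clipped to 0 in the final comparison with
    \<open>ennreal V\<close>.\<close>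
  have "0 \<le> (\<Sum>i<1. log_trunc R 0 \<bar>x 1 - x i\<bar>)" by (simp add: log_trunc_nonneg)
  then have W: "W \<ge> 0" using row[of 1 0] by simp
  \<comment> \<open>Each new point adds its row twice, by symmetry, and a diagonal entry
    \<open>m\<close>. The diagonal has order \<open>n\<close> and disappears after division by
    \<open>(n + 1)^2\<close>.\<close>
  have dbl: "(\<Sum>i\<le>n. \<Sum>j\<le>n. log_trunc R m \<bar>x i - x j\<bar>) \<le> (real n + 1)\<^sup>2 * W + (real n + 1) * real m" for n m
  proof (induction n)
    case 0
    then show ?case using W by (simp add: log_trunc_0)
  next
    case (Suc n)
    have "(\<Sum>i\<le>Suc n. \<Sum>j\<le>Suc n. log_trunc R m \<bar>x i - x j\<bar>)
      = (\<Sum>i\<le>n. \<Sum>j\<le>n. log_trunc R m \<bar>x i - x j\<bar>) + 2 * (\<Sum>i<Suc n. log_trunc R m \<bar>x (Suc n) - x i\<bar>) + real m"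
      by (simp add: sum.distrib log_trunc_0 abs_minus_commute lessThan_Suc_atMost)
    also have "\<dots> \<le> ((real n + 1)\<^sup>2 * W + (real n + 1) * real m) + 2 * (real (Suc n) * W) + real m"
      by (intro add_mono Suc mult_left_mono row) auto
    also have "\<dots> \<le> (real (Suc n) + 1)\<^sup>2 * W + (real (Suc n) + 1) * real m"
      using W by (simp add: algebra_simps power2_eq_square)
    finally show ?case .
  qed
  obtain B where B: "\<And>x. x \<in> E \<Longrightarrow> \<bar>x\<bar> \<le> B" "B > 0"
    using compact_imp_bounded[OF E(1)] by (auto simp: bounded_pos)
  have Eb: "E \<in> sets borel" using E(1) by (simp add: compact_imp_closed)
  have AEx: "AE z in empirical x n. z \<in> E" for n
    by (rule AE_empirical) (use x Eb in auto)
  have "tight (empirical x)"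
    unfolding tight_def
  proof (intro conjI allI impI)
    fix e :: real assume e: "e > 0"
    \<comment> \<open>Tightness is stated with intervals open on the left, hence
      \<open>- B - 1\<close> instead of \<open>- B\<close>.\<close>
    show "\<exists>a b. a < b \<and> (\<forall>n. 1 - e < measure (empirical x n) {a<..b})"
    proof (rule exI[of _ "- B - 1"], rule exI[of _ B], intro conjI allI)
      fix n
      interpret N: real_distribution "empirical x n" by (rule real_distribution_empirical)
      have "measure (empirical x n) {- B - 1<..B} = 1"
        by (subst N.prob_eq_1) (use AEx[of n] B in \<open>auto elim!: eventually_mono dest!: B(1)\<close>)
      then show "1 - e < measure (empirical x n) {- B - 1<..B}" using e by simp
    qed (use B in auto)
  qed (rule real_distribution_empirical)
  from tight_imp_convergent_subsubsequence[OF this strict_mono_id]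
  obtain r M where r: "strict_mono r" and M: "real_distribution M"
    and conv: "weak_conv_m (\<lambda>k. empirical x (r k)) M"
    by (auto simp: o_def)
  interpret M: real_distribution M by (rule M)
  have ME: "AE x in M. x \<in> E"
    by (rule weak_conv_AE_closed[OF real_distribution_empirical M conv compact_imp_closed[OF E(1)] AEx E(2)])
  have "(\<integral>x. trunc_pot R m M x \<partial>M) \<le> W" for m
  proof -
    have 1: "(\<lambda>k. \<integral>z. trunc_pot R m (empirical x (r k)) z \<partial>empirical x (r k)) \<longlonglongrightarrow> (\<integral>x. trunc_pot R m M x \<partial>M)"
      by (rule trunc_energy_weak_conv[OF real_distribution_empirical M conv R(1) E(1) AEx])
    have "(\<lambda>n. W + real m / (real n + 1)) \<longlonglongrightarrow> W + 0"
      using LIMSEQ_Suc[OF lim_const_over_n[of "real m"]]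
      by (intro tendsto_add tendsto_const) (simp add: add.commute)
    from LIMSEQ_subseq_LIMSEQ[OF this r]
    have 2: "(\<lambda>k. W + real m / (real (r k) + 1)) \<longlonglongrightarrow> W" by (simp add: o_def)
    have 3: "(\<integral>z. trunc_pot R m (empirical x (r k)) z \<partial>empirical x (r k)) \<le> W + real m / (real (r k) + 1)" for k
    proof -
      have "(\<integral>z. trunc_pot R m (empirical x (r k)) z \<partial>empirical x (r k))
        \<le> ((real (r k) + 1)\<^sup>2 * W + (real (r k) + 1) * real m) / (real (r k) + 1)\<^sup>2"
        unfolding trunc_energy_empirical[OF R(1)] by (intro divide_right_mono dbl) auto
      also have "\<dots> = W + real m / (real (r k) + 1)"
        by (simp add: add_divide_distrib power2_eq_square)
      finally show ?thesis .
    qed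
    show ?thesis by (rule LIMSEQ_le[OF 1 2]) (use 3 in auto)
  qed
  then have "energy R M \<le> ennreal W" by (rule M.energy_le_of_trunc_energy_le[OF R(1)])
  with V[OF M ME] have "ennreal V \<le> ennreal W" by (rule order_trans)
  then have "V \<le> W" using W by (auto simp: ennreal_le_iff2)
  then show False using e by (simp add: W_def)
qed

section \<open>Zero counting measures\<close>

lemma poly_map_poly_of_real:
  "poly (map_poly complex_of_real q) (complex_of_real x) = complex_of_real (poly q x)"
  by (induction q) (auto simp: map_poly_pCons)

lemma sum_order_complex:
  fixes Q :: "complex poly"
  assumes "Q \<noteq> 0"
  shows "(\<Sum>z\<in>{z. poly Q z = 0}. order z Q) = degree Q"
proof -
  have "degree Q = size (proots Q)" by (simp add: size_proots_complex)
  also have "\<dots> = (\<Sum>z\<in>{z. poly Q z = 0}. order z Q)"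
    using assms by (simp add: size_multiset_overloaded_eq)
  finally show ?thesis ..
qed

text \<open>\<open>measure_of\<close> returns the given set function only where that is a measure.
  This is verified by identifying it with the image of a point measure on the finite set of zeros,
  for which integrals are finite sums.\<close>

lemma integral_zero_counting_measure:
  fixes f :: "complex \<Rightarrow> real"
  assumes q: "q \<noteq> 0" and f: "f \<in> borel_measurable borel"
  defines "Q \<equiv> map_poly complex_of_real q"
  shows "(\<integral>z. f z \<partial>zero_counting_measure q)
    = (\<Sum>z\<in>{z. poly Q z = 0}. real (order z Q) / real (degree q) * f z)"
proof -
  define Z where "Z = {z. poly Q z = 0}"
  define w where "w z = real (order z Q) / real (degree q)" for z
  have Q0: "Q \<noteq> 0" using q by (simp add: Q_def map_poly_eq_0_iff)
  have Z: "finite Z" unfolding Z_def using Q0 by (rule poly_roots_finite)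
  define M where "M = distr (point_measure Z (\<lambda>z. ennreal (w z))) borel (\<lambda>z. z)"
  have M: "space M = UNIV" "sets M = sets borel" by (simp_all add: M_def)
  have "zero_counting_measure q = measure_of UNIV (sets borel) (emeasure M)"
    unfolding zero_counting_measure_def Q_def[symmetric] Z_def[symmetric]
  proof (rule measure_of_eq)
    fix A :: "complex set" assume "A \<in> sigma_sets UNIV (sets borel)"
    then have A: "A \<in> sets borel" by (metis sets.sigma_sets_eq space_borel)
    have "emeasure M A = emeasure (point_measure Z (\<lambda>z. ennreal (w z))) (Z \<inter> A)"
      unfolding M_def using A
      by (subst emeasure_distr) (auto simp: measurable_def space_point_measure sets_point_measure Int_commute)
    also have "\<dots> = (\<Sum>z\<in>Z \<inter> A. ennreal (w z))"
      using Z by (intro emeasure_point_measure_finite) auto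
    also have "\<dots> = ennreal ((\<Sum>z\<in>Z \<inter> A. real (order z Q)) / real (degree q))"
      by (subst sum_ennreal) (auto simp: w_def sum_divide_distrib)
    finally show "ennreal ((\<Sum>z\<in>Z \<inter> A. real (order z Q)) / real (degree q)) = emeasure M A" ..
  qed simp
  also have "\<dots> = M" using measure_of_of_measure[of M] by (simp add: M)
  finally have "(\<integral>z. f z \<partial>zero_counting_measure q) = (\<integral>z. f z \<partial>M)" by simp
  also have "\<dots> = (\<integral>z. f z \<partial>point_measure Z (\<lambda>z. ennreal (w z)))"
    unfolding M_def using f by (subst integral_distr) (auto simp: measurable_def space_point_measure sets_point_measure)
  also have "\<dots> = (\<Sum>z\<in>Z. w z * f z)"
    using Z by (subst lebesgue_integral_point_measure_finite) (auto simp: w_def)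
  finally show ?thesis by (simp add: Z_def w_def)
qed

text \<open>Factor the monic polynomial over the complex numbers and take logarithms: the weighted
  sum of \<open>ln (R / |x - z|)\<close> is at least \<open>ln (R / B)\<close>, as the weights sum
  to 1. Positive parts only increase it, and at a zero the sum is infinite.\<close>

lemma sum_log_pos_zeros_ge:
  fixes q :: "real poly"
  assumes q: "lead_coeff q > 0" "degree q \<ge> 1" and R: "R > 0" and B: "B > 0"
    and le: "\<bar>poly q x\<bar> \<le> lead_coeff q * B ^ degree q"
  defines "Q \<equiv> map_poly complex_of_real q"
  shows "ennreal (ln (R / B)) \<le> (\<Sum>z\<in>{z. poly Q z = 0}.
      ennreal (real (order z Q) / real (degree q)) * log_pos R (cmod (of_real x - z)))"
proof -
  define Z where "Z = {z. poly Q z = 0}"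
  define n where "n = degree q"
  define w where "w z = real (order z Q) / real n" for z
  have q0: "q \<noteq> 0" using q by auto
  have Q0: "Q \<noteq> 0" using q0 by (simp add: Q_def map_poly_eq_0_iff)
  have Z: "finite Z" unfolding Z_def using Q0 by (rule poly_roots_finite)
  have n: "n \<ge> 1" "degree Q = n" using q by (auto simp: n_def Q_def degree_map_poly)
  have lQ: "lead_coeff Q = of_real (lead_coeff q)" by (simp add: Q_def coeff_map_poly degree_map_poly)
  show ?thesis
  proof (cases "of_real x \<in> Z")
    case True
    then have "order (of_real x) Q \<noteq> 0" using Q0 by (simp add: Z_def order_root)
    then have "ennreal (w (of_real x)) * log_pos R (cmod (of_real x - of_real x)) = \<top>"
      using n by (simp add: log_pos_def w_def ennreal_mult_top)
    then have "(\<Sum>z\<in>Z. ennreal (w z) * log_pos R (cmod (of_real x - z))) = \<top>"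
      using True Z by (subst sum.remove[of _ "of_real x"]) auto
    then show ?thesis by (simp add: Z_def w_def n_def)
  next
    case False
    have "poly Q (of_real x) = lead_coeff Q * (\<Prod>z\<in>Z. (of_real x - z) ^ order z Q)"
      by (subst complex_poly_decompose[symmetric, of Q]) (simp add: poly_prod Z_def)
    then have "cmod (poly Q (of_real x)) = lead_coeff q * (\<Prod>z\<in>Z. cmod (of_real x - z) ^ order z Q)"
      using q by (simp add: lQ norm_mult prod_norm[symmetric] norm_power)
    then have "lead_coeff q * (\<Prod>z\<in>Z. cmod (of_real x - z) ^ order z Q) \<le> lead_coeff q * B ^ n"
      using le by (simp add: Q_def poly_map_poly_of_real n_def)
    then have pr: "(\<Prod>z\<in>Z. cmod (of_real x - z) ^ order z Q) \<le> B ^ n" using q by simp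
    have pos: "cmod (of_real x - z) > 0" if "z \<in> Z" for z using that False by auto
    have "(\<Sum>z\<in>Z. real (order z Q) * ln (cmod (of_real x - z))) = ln (\<Prod>z\<in>Z. cmod (of_real x - z) ^ order z Q)"
      using pos Z by (subst ln_prod) (auto simp: ln_realpow)
    also have "\<dots> \<le> ln (B ^ n)"
      using pr pos B by (subst ln_le_cancel_iff) (auto intro!: prod_pos)
    finally have s: "(\<Sum>z\<in>Z. real (order z Q) * ln (cmod (of_real x - z))) \<le> real n * ln B"
      by (simp add: ln_realpow)
    have "(\<Sum>z\<in>Z. real (order z Q)) = real n"
      using sum_order_complex[OF Q0] n by (simp add: Z_def flip: of_nat_sum)
    then have "real n * ln (R / B) \<le> (\<Sum>z\<in>Z. real (order z Q) * (ln R - ln (cmod (of_real x - z))))"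
      using s R B by (simp add: right_diff_distrib sum_subtractf ln_div flip: sum_distrib_right)
    also have "\<dots> \<le> (\<Sum>z\<in>Z. real (order z Q) * max 0 (ln (R / cmod (of_real x - z))))"
      using pos R by (intro sum_mono mult_left_mono) (auto simp: ln_div)
    also have "\<dots> = real n * (\<Sum>z\<in>Z. w z * max 0 (ln (R / cmod (of_real x - z))))"
      using n by (simp add: w_def sum_distrib_left)
    finally have "ln (R / B) \<le> (\<Sum>z\<in>Z. w z * max 0 (ln (R / cmod (of_real x - z))))"
      using n by simp
    then have "ennreal (ln (R / B)) \<le> ennreal (\<Sum>z\<in>Z. w z * max 0 (ln (R / cmod (of_real x - z))))"
      by (rule ennreal_leI)
    also have "\<dots> = (\<Sum>z\<in>Z. ennreal (w z * max 0 (ln (R / cmod (of_real x - z)))))"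
      by (subst sum_ennreal) (auto simp: w_def)
    also have "\<dots> = (\<Sum>z\<in>Z. ennreal (w z) * log_pos R (cmod (of_real x - z)))"
    proof (intro sum.cong refl)
      fix z assume "z \<in> Z"
      then have "log_pos R (cmod (of_real x - z)) = ennreal (max 0 (ln (R / cmod (of_real x - z))))"
        using pos[of z] by (simp add: log_pos_def ennreal_max_0 max.commute)
      then show "ennreal (w z * max 0 (ln (R / cmod (of_real x - z)))) = ennreal (w z) * log_pos R (cmod (of_real x - z))"
        by (simp only:) (rule ennreal_mult, auto simp: w_def)
    qed
    finally show ?thesis by (simp add: Z_def w_def n_def)
  qed
qed

section \<open>Orthogonal polynomials\<close>

text \<open>The complement of the support is a union of null balls, of which countably many suffice
  by Lindelof's theorem.\<close>

lemma measure_support_AE: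
  fixes mu :: "real measure"
  assumes sets: "sets mu = sets borel"
  shows "AE x in mu. x \<in> measure_support mu"
proof -
  define \<F> where "\<F> = {ball x e | x e. e > 0 \<and> emeasure mu (ball x e) = 0}"
  obtain \<F>' where F': "\<F>' \<subseteq> \<F>" "countable \<F>'" "\<Union>\<F>' = \<Union>\<F>"
    using Lindelof[of \<F>] unfolding \<F>_def by blast
  have "(\<Union>B\<in>\<F>'. B) \<in> null_sets mu"
    using F'(1) by (intro null_sets_UN' F'(2)) (auto simp: \<F>_def null_sets_def sets)
  then have "\<Union>\<F> \<in> null_sets mu" using F'(3) by simp
  then show ?thesis
  proof (rule AE_I')
    show "{x \<in> space mu. x \<notin> measure_support mu} \<subseteq> \<Union>\<F>"
      by (force simp: measure_support_def \<F>_def)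
  qed
qed

locale orthonormal_system =
  fixes mu :: "real measure" and p :: "nat \<Rightarrow> real poly"
  assumes sets_mu: "sets mu = sets borel" and finite_mu: "finite_measure mu"
    and cpt: "compact (measure_support mu)" and ops: "orthonormal_polys mu p"
begin

lemma deg: "degree (p n) = n" and lead: "lead_coeff (p n) > 0"
  and orth: "(\<integral>x. poly (p m) x * poly (p n) x \<partial>mu) = (if m = n then 1 else 0)"
  using ops unfolding orthonormal_polys_def by blast+

lemma poly_integrable: "integrable mu (poly q)"
proof -
  interpret finite_measure mu by (rule finite_mu)
  have "compact (poly q ` measure_support mu)"
    by (intro compact_continuous_image cpt continuous_intros)
  then have "bounded (poly q ` measure_support mu)" by (rule compact_imp_bounded)
  then obtain C where C: "\<And>x. x \<in> measure_support mu \<Longrightarrow> norm (poly q x) \<le> C"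
    unfolding bounded_iff by (metis imageI)
  have "poly q \<in> borel_measurable mu"
    by (subst measurable_cong_sets[OF sets_mu refl]) (intro borel_measurable_continuous_onI continuous_intros)
  then  show ?thesis
    using measure_support_AE[OF sets_mu] C
    by (intro integrable_const_bound[where B = C]) (auto elim!: eventually_mono)
qed

lemma poly_mult_integrable: "integrable mu (\<lambda>x. poly q x * poly r x)"
proof -
  have "poly (q * r) = (\<lambda>x. poly q x * poly r x)" by (simp add: fun_eq_iff)
  then show ?thesis using poly_integrable[of "q * r"] by simp
qed

text \<open>Subtracting a multiple of \<open>p d\<close> removes the leading term, and induction
  handles the rest. The alternative \<open>q = 0\<close> covers vanishing remainders, whose degree 0
  is not below \<open>n\<close> when \<open>n = 0\<close>.\<close>

lemma orth_lower: "degree q < n \<or> q = 0 \<Longrightarrow> (\<integral>x. poly q x * poly (p n) x \<partial>mu) = 0"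
proof (induction "degree q" arbitrary: q rule: less_induct)
  case less
  show ?case
  proof (cases "q = 0")
    case False
    define d where "d = degree q"
    define c where "c = lead_coeff q / lead_coeff (p d)"
    define r where "r = q - smult c (p d)"
    have dn: "d < n" using less.prems False by (simp add: d_def)
    have r: "degree r < d \<or> r = 0"
    proof -
      have "degree r \<le> d" unfolding r_def by (rule degree_diff_le) (auto simp: d_def deg)
      moreover have "coeff r d = 0" using lead[of d] by (simp add: r_def c_def deg d_def)
      ultimately show ?thesis by (metis leading_coeff_0_iff order_le_less)
    qed
    have "(\<integral>x. poly r x * poly (p n) x \<partial>mu) = 0"
      using r dn by (cases "r = 0") (auto intro!: less.hyps simp: d_def)
    moreover have "(\<integral>x. poly q x * poly (p n) x \<partial>mu)
        = (\<integral>x. poly r x * poly (p n) x + c * (poly (p d) x * poly (p n) x) \<partial>mu)"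
      by (intro Bochner_Integration.integral_cong) (auto simp: r_def algebra_simps)
    moreover have "\<dots> = (\<integral>x. poly r x * poly (p n) x \<partial>mu) + c * (\<integral>x. poly (p d) x * poly (p n) x \<partial>mu)"
      using poly_mult_integrable by simp
    ultimately show ?thesis using orth[of d n] dn by simp
  qed simp
qed

text \<open>Pythagoras: \<open>q\<close> is \<open>p n\<close> divided by its leading coefficient
  plus a remainder of lower degree, and the remainder is orthogonal to \<open>p n\<close>.\<close>

lemma monic_L2_ge:
  assumes "lead_coeff q = 1" "degree q = n"
  shows "(1 / lead_coeff (p n))\<^sup>2 \<le> (\<integral>x. (poly q x)\<^sup>2 \<partial>mu)"
proof -
  define c where "c = 1 / lead_coeff (p n)"
  define r where "r = q - smult c (p n)"
  have r: "degree r < n \<or> r = 0"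
  proof -
    have "degree r \<le> n" unfolding r_def by (rule degree_diff_le) (auto simp: assms deg)
    moreover have "coeff r n = 0" using lead[of n] assms by (simp add: r_def c_def deg)
    ultimately show ?thesis by (metis leading_coeff_0_iff order_le_less)
  qed
  have "(\<integral>x. (poly q x)\<^sup>2 \<partial>mu) = (\<integral>x. poly r x * poly r x + (2 * c * (poly r x * poly (p n) x) + c\<^sup>2 * (poly (p n) x * poly (p n) x)) \<partial>mu)"
    by (intro Bochner_Integration.integral_cong) (auto simp: r_def algebra_simps power2_eq_square)
  also have "\<dots> = (\<integral>x. poly r x * poly r x \<partial>mu) + (2 * c * (\<integral>x. poly r x * poly (p n) x \<partial>mu) + c\<^sup>2 * (\<integral>x. poly (p n) x * poly (p n) x \<partial>mu))"
    using poly_mult_integrable by simp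
  also have "\<dots> = (\<integral>x. poly r x * poly r x \<partial>mu) + c\<^sup>2"
    using orth_lower[OF r] orth[of n n] by simp
  also have "\<dots> \<ge> c\<^sup>2" by simp
  finally show ?thesis by (simp add: c_def)
qed

text \<open>Compare the coefficients of degree \<open>n + 1\<close> in the recurrence. The factor
  \<open>lead_coeff (p 0)\<close> remains because the total mass of \<open>mu\<close> is not
  normalized.\<close>

lemma lead_prod_jacobi:
  assumes "jacobi_parameters p a b"
  shows "lead_coeff (p n) * (\<Prod>i=1..n. a i) = lead_coeff (p 0)"
proof (induction n)
  case (Suc n)
  have rec: "[:0, 1:] * p n = smult (a (n + 1)) (p (n + 1)) + smult (b (n + 1)) (p n)
          + (if n = 0 then 0 else smult (a n) (p (n - 1)))"
    using assms by (simp add: jacobi_parameters_def)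
  have "coeff ([:0, 1:] * p n) (Suc n) = coeff (p n) n" by simp
  moreover have "coeff (p n) (Suc n) = 0" "n \<noteq> 0 \<Longrightarrow> coeff (p (n - 1)) (Suc n) = 0"
    by (auto intro!: coeff_eq_0 simp: deg)
  ultimately have "coeff (p n) n = a (Suc n) * coeff (p (Suc n)) (Suc n)"
    unfolding rec by (cases "n = 0") auto
  then show ?case using Suc by (simp add: deg mult_ac)
qed simp

end

section \<open>Energies of measures in the complex plane\<close>

lemma real_distribution_distr_Re:
  assumes "nu \<in> prob_measures_on (complex_of_real ` E)" "E \<in> sets borel"
  shows "real_distribution (distr nu borel Re)" "AE x in distr nu borel Re. x \<in> E"
    "AE z in nu. z \<in> complex_of_real ` E"
proof -
  have nu: "prob_space nu" "sets nu = sets borel" "emeasure nu (UNIV - complex_of_real ` E) = 0"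
    using assms(1) by (auto simp: prob_measures_on_def)
  interpret prob_space nu by (rule nu)
  note [measurable_cong] = nu(2)
  note [measurable] = assms(2)
  have sp: "space nu = UNIV" using sets_eq_imp_space_eq[OF nu(2)] by simp
  have "complex_of_real ` E = Re -` E \<inter> {z. Im z = 0}" by (auto simp: complex_eq_iff image_iff)
  also have "\<dots> \<in> sets borel" by measurable
  finally have E: "complex_of_real ` E \<in> sets borel" .
  show "real_distribution (distr nu borel Re)"
    unfolding real_distribution_def real_distribution_axioms_def by (auto intro!: prob_space_distr)
  show *: "AE z in nu. z \<in> complex_of_real ` E"
    by (rule AE_I[of _ _ "UNIV - complex_of_real ` E"]) (use E nu sp in auto)
  show "AE x in distr nu borel Re. x \<in> E"
    by (subst AE_distr_iff) (use * in \<open>auto elim!: eventually_mono\<close>)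
qed

text \<open>On \<open>E\<close> the kernels satisfy
  \<open>log_kernel_pos + ln R = G + log_kernel_neg\<close>, and \<open>R >= 1\<close> makes
  \<open>ln R\<close> nonnegative. The negative part is bounded by \<open>ln R\<close>, so its
  integral is finite and may be subtracted, even when the energy is infinite.\<close>

lemma log_energy_eq:
  assumes nu: "nu \<in> prob_measures_on (complex_of_real ` E)" and E: "E \<in> sets borel"
    and R: "R \<ge> 1" "\<And>x y. x \<in> E \<Longrightarrow> y \<in> E \<Longrightarrow> \<bar>x - y\<bar> \<le> R"
  shows "log_energy nu = enn2ereal (energy R (distr nu borel Re)) - ereal (ln R)"
proof -
  have nu': "prob_space nu" "sets nu = sets borel"
    using nu by (auto simp: prob_measures_on_def)
  interpret prob_space nu by (rule nu')
  interpret P: pair_prob_space nu nu ..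
  note [measurable_cong] = nu'(2)
  note AE = real_distribution_distr_Re(3)[OF nu E]
  define G where "G z = log_pos R \<bar>Re (fst z) - Re (snd z)\<bar>" for z :: "complex \<times> complex"
  have [measurable]: "G \<in> borel_measurable (borel \<Otimes>\<^sub>M borel)" unfolding G_def by measurable
  have [measurable]: "log_kernel_pos \<in> borel_measurable (borel \<Otimes>\<^sub>M borel)"
    unfolding log_kernel_pos_def by measurable
  have [measurable]: "log_kernel_neg \<in> borel_measurable (borel \<Otimes>\<^sub>M borel)"
    unfolding log_kernel_neg_def by measurable
  have en: "energy R (distr nu borel Re) = (\<integral>\<^sup>+ z. G z \<partial>(nu \<Otimes>\<^sub>M nu))"
  proof -
    have lp: "log_pot R (distr nu borel Re) x = (\<integral>\<^sup>+ w. log_pos R \<bar>x - Re w\<bar> \<partial>nu)" for x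
      unfolding log_pot_def by (subst nn_integral_distr) auto
    have "energy R (distr nu borel Re) = (\<integral>\<^sup>+ v. \<integral>\<^sup>+ w. G (v, w) \<partial>nu \<partial>nu)"
      unfolding energy_def lp G_def by (subst nn_integral_distr) auto
    also have "\<dots> = (\<integral>\<^sup>+ z. G z \<partial>(nu \<Otimes>\<^sub>M nu))" by (rule nn_integral_fst) measurable
    finally show ?thesis .
  qed
  have pt: "log_kernel_pos (complex_of_real x, complex_of_real y) + ennreal (ln R)
        = G (complex_of_real x, complex_of_real y) + log_kernel_neg (complex_of_real x, complex_of_real y)
      \<and> log_kernel_neg (complex_of_real x, complex_of_real y) \<le> ennreal (ln R)" if "x \<in> E" "y \<in> E" for x y
  proof (cases "x = y")
    case False
    define t where "t = \<bar>x - y\<bar>"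
    have t: "t > 0" "t \<le> R" using R(2)[OF that] False by (auto simp: t_def)
    have c: "cmod (complex_of_real x - complex_of_real y) = t"
      unfolding t_def by (simp flip: of_real_diff)
    have tR: "ln t \<le> ln R" "0 \<le> ln R" using t R by auto
    have *: "ennreal (- ln t) + ennreal (ln R) = ennreal (ln R - ln t) + ennreal (ln t)"
    proof (cases "ln t \<ge> 0")
      case True
      then show ?thesis using tR by (simp add: ennreal_neg del: ln_ge_zero_iff flip: ennreal_plus)
    next
      case False
      then have "ennreal (ln t) = 0" by (intro ennreal_neg) simp
      then show ?thesis using tR False by (simp add: add.commute del: ln_ge_zero_iff flip: ennreal_plus)
    qed
    show ?thesis using False t R tR *
      by (auto simp: log_kernel_pos_def log_kernel_neg_def G_def log_pos_def c ln_div t_def[symmetric] intro!: ennreal_leI)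
  qed (simp add: log_kernel_pos_def log_kernel_neg_def G_def log_pos_def)
  have AE2: "AE z in nu \<Otimes>\<^sub>M nu. log_kernel_pos z + ennreal (ln R) = G z + log_kernel_neg z
      \<and> log_kernel_neg z \<le> ennreal (ln R)"
  proof (rule P.AE_pair_measure)
    show "AE v in nu. AE w in nu. log_kernel_pos (v, w) + ennreal (ln R) = G (v, w) + log_kernel_neg (v, w)
      \<and> log_kernel_neg (v, w) \<le> ennreal (ln R)"
      using AE
    proof eventually_elim
      case (elim v)
      show ?case using AE by eventually_elim (use elim pt in auto)
    qed
  qed measurable
  define P N where "P = (\<integral>\<^sup>+ z. log_kernel_pos z \<partial>(nu \<Otimes>\<^sub>M nu))"
    and "N = (\<integral>\<^sup>+ z. log_kernel_neg z \<partial>(nu \<Otimes>\<^sub>M nu))"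
  have one: "emeasure (nu \<Otimes>\<^sub>M nu) (space (nu \<Otimes>\<^sub>M nu)) = 1" by (rule P.emeasure_space_1)
  have "P + ennreal (ln R) = (\<integral>\<^sup>+ z. log_kernel_pos z + ennreal (ln R) \<partial>(nu \<Otimes>\<^sub>M nu))"
    unfolding P_def by (subst nn_integral_add) (auto simp: one)
  also have "\<dots> = (\<integral>\<^sup>+ z. G z + log_kernel_neg z \<partial>(nu \<Otimes>\<^sub>M nu))"
    by (rule nn_integral_cong_AE) (use AE2 in eventually_elim, simp)
  also have "\<dots> = energy R (distr nu borel Re) + N"
    unfolding en N_def by (subst nn_integral_add) auto
  finally have eq: "P + ennreal (ln R) = energy R (distr nu borel Re) + N" .
  have "N \<le> (\<integral>\<^sup>+ z. ennreal (ln R) \<partial>(nu \<Otimes>\<^sub>M nu))"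
    unfolding N_def by (rule nn_integral_mono_AE) (use AE2 in eventually_elim, simp)
  then have "N \<le> ennreal (ln R)" by (simp add: one)
  then have "N < \<top>" using ennreal_less_top le_less_trans by blast
  then obtain n where n: "N = ennreal n" "n \<ge> 0" by (auto simp: less_top_ennreal)
  have lR: "0 \<le> ln R" using R by simp
  show ?thesis
    unfolding log_energy_def P_def[symmetric] N_def[symmetric] n(1)
  proof (cases P rule: ennreal_cases)
    case top
    then have "energy R (distr nu borel Re) = \<top>" 
      using eq n ennreal_add_eq_top[of "energy R (distr nu borel Re)" "ennreal n"] by auto
    then show "enn2ereal P - enn2ereal (ennreal n) = enn2ereal (energy R (distr nu borel Re)) - ereal (ln R)"
      using top n by simp
  next
    case (real c)
    then have "energy R (distr nu borel Re) + ennreal n = ennreal (c + ln R)" using eq n lR by simp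
    moreover from this have "energy R (distr nu borel Re) < \<top>"
      by (metis ennreal_add_eq_top ennreal_less_top less_top)
    then obtain g where g: "energy R (distr nu borel Re) = ennreal g" "g \<ge> 0" by (auto simp: less_top_ennreal)
    ultimately have "ennreal (g + n) = ennreal (c + ln R)" using n by simp
    then have "g + n = c + ln R" using g n real lR by (subst (asm) ennreal_inj) auto
    then show "enn2ereal P - enn2ereal (ennreal n) = enn2ereal (energy R (distr nu borel Re)) - ereal (ln R)"
      using g n real by (simp add: enn2ereal_ennreal)
  qed
qed

text \<open>With the projection by \<open>Re\<close> in the other direction, this lets energies be
  minimized over measures on the line instead of measures in the plane.\<close>

lemma prob_measures_on_distr_of_real:
  assumes N: "real_distribution N" "AE x in N. x \<in> E" and E: "E \<in> sets borel"
  shows "distr N borel complex_of_real \<in> prob_measures_on (complex_of_real ` E)"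
    "distr (distr N borel complex_of_real) borel Re = N"
proof -
  interpret real_distribution N by (rule N)
  note [measurable] = E
  have "complex_of_real ` E = Re -` E \<inter> {z. Im z = 0}" by (auto simp: complex_eq_iff image_iff)
  also have "\<dots> \<in> sets borel" by measurable
  finally have Em[measurable]: "complex_of_real ` E \<in> sets borel" .
  have "emeasure (distr N borel complex_of_real) (UNIV - complex_of_real ` E) = emeasure N (UNIV - E)"
    by (subst emeasure_distr) (auto intro!: arg_cong2[where f = emeasure])
  also have "\<dots> = 0" using N(2) by (subst (asm) AE_iff_measurable[of "UNIV - E"]) auto
  finally show "distr N borel complex_of_real \<in> prob_measures_on (complex_of_real ` E)"
    by (auto simp: prob_measures_on_def intro!: prob_space_distr)
  show "distr (distr N borel complex_of_real) borel Re = N"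
    by (subst distr_distr) (auto simp: o_def intro!: distr_id2)
qed

text \<open>Positive capacity rules out infinite minimal energy. With the shift by
  \<open>ln R\<close>, the minimum is \<open>V - ln R\<close>, and \<open>exp (- (V - ln R))\<close>
  is \<open>R * exp (- V)\<close>.\<close>

lemma equilibrium_energy:
  assumes E: "compact E" and R: "R \<ge> 1" "\<And>x y. x \<in> E \<Longrightarrow> y \<in> E \<Longrightarrow> \<bar>x - y\<bar> \<le> R"
    and cap: "cap_compact (complex_of_real ` E) > 0"
    and equi: "equilibrium_measure (complex_of_real ` E) rho"
  obtains V where "V \<ge> 0" "energy R (distr rho borel Re) = ennreal V"
    "cap_compact (complex_of_real ` E) = R * exp (- V)"
    "\<forall>N. real_distribution N \<and> (AE x in N. x \<in> E) \<longrightarrow> ennreal V \<le> energy R N"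
proof -
  have Eb: "E \<in> sets borel" using E by (simp add: compact_imp_closed)
  have rho: "rho \<in> prob_measures_on (complex_of_real ` E)" "log_energy rho = min_energy (complex_of_real ` E)"
    using equi by (auto simp: equilibrium_measure_def)
  note le = log_energy_eq[OF _ Eb R]
  have ne: "min_energy (complex_of_real ` E) \<noteq> \<infinity>" using cap by (auto simp: cap_compact_def)
  then have "energy R (distr rho borel Re) \<noteq> \<top>"
    using le[OF rho(1)] rho(2) by auto
  then obtain V where V: "energy R (distr rho borel Re) = ennreal V" "V \<ge> 0"
    by (metis ennreal_cases)
  have me: "min_energy (complex_of_real ` E) = ereal (V - ln R)"
    using le[OF rho(1)] rho(2) V by (simp add: enn2ereal_ennreal)
  have min: "ennreal V \<le> energy R N" if N: "real_distribution N" "AE x in N. x \<in> E" for N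
  proof -
    have "min_energy (complex_of_real ` E) \<le> log_energy (distr N borel complex_of_real)"
      unfolding min_energy_def by (rule INF_lower) (rule prob_measures_on_distr_of_real[OF N Eb])
    also have "\<dots> = enn2ereal (energy R N) - ereal (ln R)"
      using le[OF prob_measures_on_distr_of_real(1)[OF N Eb]] prob_measures_on_distr_of_real(2)[OF N Eb] by simp
    finally have "ereal V \<le> enn2ereal (energy R N)"
      unfolding me by (cases "enn2ereal (energy R N)") auto
    then show ?thesis
      using V(2) by (simp add: less_eq_ennreal.rep_eq enn2ereal_ennreal)
  qed
  have "cap_compact (complex_of_real ` E) = R * exp (- V)"
    using R by (simp add: cap_compact_def me exp_diff exp_minus field_simps)
  with min V show ?thesis by (intro that[of V]) auto
qed

text \<open>Nonzero capacity means that the infimum of the energies is not infinite, so one of the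
  competing measures has finite energy. It is then projected to the line.\<close>

lemma finite_energy_of_cap_pos:
  assumes K: "compact K" "K \<subseteq> complex_of_real ` E"
    and R: "R \<ge> 1" "\<And>x y. x \<in> E \<Longrightarrow> y \<in> E \<Longrightarrow> \<bar>x - y\<bar> \<le> R"
    and cap: "cap_compact K \<noteq> 0"
  obtains N where "real_distribution N" "AE x in N. complex_of_real x \<in> K" "energy R N < \<infinity>"
proof -
  define F where "F = Re ` K"
  have KF: "K = complex_of_real ` F" using K(2) by (force simp: F_def)
  have "compact F" unfolding F_def by (intro compact_continuous_image K continuous_intros)
  then have F: "F \<in> sets borel" by (simp add: compact_imp_closed)
  have FE: "F \<subseteq> E" using K(2) by (auto simp: F_def)
  have "min_energy K \<noteq> \<infinity>" using cap by (auto simp: cap_compact_def)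
  then have "\<exists>nu\<in>prob_measures_on K. log_energy nu \<noteq> \<infinity>"
    unfolding min_energy_def by (metis INF_eq_const INF_top_conv(1) top_ereal_def)
  then obtain nu where nu: "nu \<in> prob_measures_on (complex_of_real ` F)" "log_energy nu \<noteq> \<infinity>"
    using KF by auto
  have "log_energy nu = enn2ereal (energy R (distr nu borel Re)) - ereal (ln R)"
    by (rule log_energy_eq[OF nu(1) F R(1)]) (use FE R in auto)
  then have "energy R (distr nu borel Re) < \<infinity>"
    using nu(2)
    by (cases "energy R (distr nu borel Re)" rule: ennreal_cases) auto
  moreover have "AE x in distr nu borel Re. complex_of_real x \<in> K"
    using real_distribution_distr_Re(2)[OF nu(1) F] by (auto simp: KF elim!: eventually_mono)
  ultimately show ?thesis using that real_distribution_distr_Re(1)[OF nu(1) F] by blast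
qed

text \<open>The upper envelope argument. Zeros off the real axis do no harm, since projecting
  them to the axis only increases the potential.\<close>
lemma equilibrium_root_asymptotics_le:
  fixes q :: "nat \<Rightarrow> real poly"
  assumes q: "\<And>i. lead_coeff (q i) > 0" "\<And>i. degree (q i) \<ge> 1"
    and conv: "weak_conv_complex (\<lambda>i. zero_counting_measure (q i)) rho"
    and rho: "prob_space rho" "sets rho = sets borel"
    and R: "R > 0" and V: "V \<ge> 0" "\<And>x. log_pot R (distr rho borel Re) x \<le> ennreal V"
    and N: "real_distribution N" "energy R N < \<infinity>" and B: "B > 0"
    and le: "AE x in N. \<forall>\<^sub>F i in sequentially. \<bar>poly (q i) x\<bar> \<le> lead_coeff (q i) * B ^ degree (q i)"
  shows "R * exp (- V) \<le> B"
proof -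
  interpret N: real_distribution N by (rule N)
  interpret rho: prob_space rho by (rule rho)
  note [measurable_cong] = rho(2)
  define P where "P = distr rho borel Re"
  interpret P: real_distribution P
    unfolding real_distribution_def real_distribution_axioms_def P_def by (auto intro!: rho.prob_space_distr)
  \<comment> \<open>Conditioning on \<open>S\<close> turns \<open>N\<close> into a measure whose
    potential is, up to any \<open>e\<close>, uniformly bounded by a continuous truncated potential.
    Almost-everywhere statements pass from \<open>N\<close> to it.\<close>
  obtain S where S[measurable]: "S \<in> sets borel" and S0: "emeasure N S \<noteq> 0"
    and unif: "\<And>e. e > 0 \<Longrightarrow> \<exists>m. \<forall>x. log_pot R (uniform_measure N S) x
        \<le> ennreal (trunc_pot R m (uniform_measure N S) x + e)"
    using N.uniform_truncation[OF R N(2)] by blast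
  define L where "L = uniform_measure N S"
  interpret L: real_distribution L
    unfolding real_distribution_def real_distribution_axioms_def L_def
    using S0 by (auto intro!: prob_space_uniform_measure)
  have leL: "AE x in L. \<forall>\<^sub>F i in sequentially. \<bar>poly (q i) x\<bar> \<le> lead_coeff (q i) * B ^ degree (q i)"
    unfolding L_def by (rule AE_uniform_measureI) (use le in \<open>auto elim!: eventually_mono\<close>)
  define Z where "Z i = {z. poly (map_poly complex_of_real (q i)) z = 0}" for i
  define w where "w i z = real (order z (map_poly complex_of_real (q i))) / real (degree (q i))" for i z
  have q0: "q i \<noteq> 0" for i using q(1)[of i] by auto
  have w0: "w i z \<ge> 0" for i z by (simp add: w_def)
  \<comment> \<open>The potential on the line of the normalized zeros of \<open>q i\<close>, zeros
    off the axis included.\<close>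
  define h where "h i x = (\<Sum>z\<in>Z i. ennreal (w i z) * log_pos R (cmod (of_real x - z)))" for i x
  have hm[measurable]: "h i \<in> borel_measurable borel" for i
    unfolding h_def by measurable
  have main: "ln (R / B) \<le> V + e" if e: "e > 0" for e
  proof -
    obtain m where m: "\<And>x. log_pot R L x \<le> ennreal (trunc_pot R m L x + e)"
      using unif[OF e] unfolding L_def by blast
    \<comment> \<open>A bounded continuous majorant of the potential of \<open>L\<close> at the
      projected point, to which weak convergence of the zero counting measures applies.\<close>
    define f where "f z = trunc_pot R m L (Re z) + e" for z
    have fc: "continuous_on UNIV f" unfolding f_def
      by (intro continuous_intros continuous_on_compose2[OF L.continuous_trunc_pot[OF R, of UNIV m]]) auto
    have fb: "0 \<le> f z" "f z \<le> real m + e" for z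
      using L.trunc_pot_nonneg[of R m "Re z"] L.trunc_pot_le[of R m "Re z"] e by (auto simp: f_def)
    have fm[measurable]: "f \<in> borel_measurable borel" using fc by (rule borel_measurable_continuous_onI)
    have lim: "(\<lambda>i. \<integral>z. f z \<partial>zero_counting_measure (q i)) \<longlonglongrightarrow> (\<integral>z. f z \<partial>rho)"
    proof -
      have "bounded (range f)"
        unfolding bounded_iff using fb by (intro exI[of _ "real m + e"]) auto
      then show ?thesis using conv fc by (simp add: weak_conv_complex_def)
    qed
    have hi: "(\<integral>\<^sup>+ x. h i x \<partial>L) \<le> ennreal (\<integral>z. f z \<partial>zero_counting_measure (q i))" for i
    proof -
      have "(\<integral>\<^sup>+ x. h i x \<partial>L) = (\<Sum>z\<in>Z i. ennreal (w i z) * (\<integral>\<^sup>+ x. log_pos R (cmod (of_real x - z)) \<partial>L))"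
        unfolding h_def by (subst nn_integral_sum) (auto simp: nn_integral_cmult)
      also have "\<dots> \<le> (\<Sum>z\<in>Z i. ennreal (w i z) * ennreal (f z))"
      proof (intro sum_mono mult_left_mono)
        fix z
        have "(\<integral>\<^sup>+ x. log_pos R (cmod (of_real x - z)) \<partial>L) \<le> log_pot R L (Re z)"
          unfolding log_pot_def
        proof (intro nn_integral_mono log_pos_antimono R)
          fix x show "\<bar>Re z - x\<bar> \<le> cmod (of_real x - z)"
            using abs_Re_le_cmod[of "of_real x - z"] by simp
        qed simp
        also have "\<dots> \<le> ennreal (f z)" unfolding f_def by (rule m)
        finally show "(\<integral>\<^sup>+ x. log_pos R (cmod (of_real x - z)) \<partial>L) \<le> ennreal (f z)" .
      qed simp
      also have "\<dots> = (\<Sum>z\<in>Z i. ennreal (w i z * f z))"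
        using fb w0 by (intro sum.cong refl) (simp add: ennreal_mult)
      also have "\<dots> = ennreal (\<Sum>z\<in>Z i. w i z * f z)"
        using fb w0 by (intro sum_ennreal) auto
      also have "(\<Sum>z\<in>Z i. w i z * f z) = (\<integral>z. f z \<partial>zero_counting_measure (q i))"
        by (subst integral_zero_counting_measure[OF q0 fm]) (simp add: Z_def w_def)
      finally show ?thesis .
    qed
    \<comment> \<open>Fatou's lemma takes the limit inferior out of the integral, \<open>hi\<close>
      and weak convergence lead to the integral of \<open>f\<close> against \<open>rho\<close>, and
      Fubini's theorem turns this into the truncated potential of the projected \<open>rho\<close>,
      which is at most \<open>V\<close>.\<close>
    have "ennreal (ln (R / B)) = (\<integral>\<^sup>+ x. ennreal (ln (R / B)) \<partial>L)"
      by (simp add: L.emeasure_space_1[simplified])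
    also have "\<dots> \<le> (\<integral>\<^sup>+ x. liminf (\<lambda>i. h i x) \<partial>L)"
    proof (rule nn_integral_mono_AE, use leL in eventually_elim)
      case (elim x)
      show ?case
      proof (rule Liminf_bounded, use elim in eventually_elim)
        case (elim i)
        show ?case unfolding h_def Z_def w_def by (rule sum_log_pos_zeros_ge[OF q R B elim])
      qed
    qed
    also have "\<dots> \<le> liminf (\<lambda>i. \<integral>\<^sup>+ x. h i x \<partial>L)"
      by (rule nn_integral_liminf) measurable
    also have "\<dots> \<le> liminf (\<lambda>i. ennreal (\<integral>z. f z \<partial>zero_counting_measure (q i)))"
      by (intro Liminf_mono always_eventually allI hi)
    also have "\<dots> = ennreal (\<integral>z. f z \<partial>rho)"
      by (intro lim_imp_Liminf tendsto_ennrealI lim) simp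
    also have "\<dots> = (\<integral>\<^sup>+ z. ennreal (f z) \<partial>rho)"
      using fb by (intro nn_integral_eq_integral[symmetric] rho.integrable_const_bound[where B = "real m + e"]) auto
    also have "\<dots> = (\<integral>\<^sup>+ z. ennreal (trunc_pot R m L (Re z)) + ennreal e \<partial>rho)"
      unfolding f_def using e by (simp add: L.trunc_pot_nonneg)
    also have "\<dots> = (\<integral>\<^sup>+ y. ennreal (trunc_pot R m L y) \<partial>P) + ennreal e"
    proof -
      have [measurable]: "trunc_pot R m L \<in> borel_measurable borel"
        by (intro borel_measurable_continuous_onI L.continuous_trunc_pot R)
      show ?thesis unfolding P_def
        by (subst nn_integral_add) (auto simp: nn_integral_distr rho.emeasure_space_1)
    qed
    also have "(\<integral>\<^sup>+ y. ennreal (trunc_pot R m L y) \<partial>P) = (\<integral>\<^sup>+ y. \<integral>\<^sup>+ x. ennreal (log_trunc R m \<bar>y - x\<bar>) \<partial>L \<partial>P)"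
      by (simp add: L.ennreal_trunc_pot)
    also have "\<dots> = (\<integral>\<^sup>+ x. \<integral>\<^sup>+ y. ennreal (log_trunc R m \<bar>y - x\<bar>) \<partial>P \<partial>L)"
    proof (rule pair_sigma_finite.Fubini')
      show "pair_sigma_finite L P" by standard
    qed measurable
    also have "\<dots> \<le> (\<integral>\<^sup>+ x. ennreal V \<partial>L)"
    proof (rule nn_integral_mono)
      fix x
      have "(\<integral>\<^sup>+ y. ennreal (log_trunc R m \<bar>y - x\<bar>) \<partial>P) \<le> log_pot R P x"
        unfolding log_pot_def abs_minus_commute[of x]
        by (intro nn_integral_mono log_trunc_le_log_pos R) auto
      then show "(\<integral>\<^sup>+ y. ennreal (log_trunc R m \<bar>y - x\<bar>) \<partial>P) \<le> ennreal V"
        using V(2)[of x] by (simp add: P_def)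
    qed
    also have "\<dots> = ennreal V" by (simp add: L.emeasure_space_1[simplified])
    finally have "ennreal (ln (R / B)) \<le> ennreal (V + e)" using V e by simp
    then show ?thesis using V e by (subst (asm) ennreal_le_iff2) auto
  qed
  have "ln (R / B) \<le> V" by (rule field_le_epsilon) (rule main)
  then have "exp (ln (R / B)) \<le> exp V" by simp
  then have "R / B \<le> exp V" using R B by simp
  then show ?thesis using B by (simp add: exp_minus field_simps)
qed

section \<open>Leading coefficients and pointwise size of orthonormal polynomials\<close>

context orthonormal_system begin

text \<open>The competitor in \<open>monic_L2_ge\<close> is a power of the small polynomial, filled
  up to degree \<open>n\<close> by fewer than \<open>k\<close> factors \<open>x - x0\<close>. Each
  filler costs \<open>R\<close> in place of \<open>s\<close>, which \<open>max 1 (R / s) ^ k\<close>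
  absorbs for all \<open>n\<close> at once.\<close>

lemma lead_ge_of_small_polynomial:
  assumes E: "E = measure_support mu" "x0 \<in> E" and R: "\<And>x y. x \<in> E \<Longrightarrow> y \<in> E \<Longrightarrow> \<bar>x - y\<bar> \<le> R"
    and k: "k \<ge> 1" and s: "s > 0"
    and xs: "\<And>x. x \<in> E \<Longrightarrow> (\<Prod>i<k. \<bar>x - xs i\<bar>) \<le> s ^ k"
  shows "1 / lead_coeff (p n) \<le> sqrt (measure mu UNIV) * max 1 (R / s) ^ k * s ^ n"
proof -
  interpret finite_measure mu by (rule finite_mu)
  have sp: "space mu = UNIV" using sets_eq_imp_space_eq[OF sets_mu] by simp
  define Q where "Q = (\<Prod>i<k. [:- xs i, 1:]) ^ (n div k) * [:- x0, 1:] ^ (n mod k)"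
  have R0: "R \<ge> 0" using R[OF E(2) E(2)] by simp
  have lQ: "lead_coeff Q = 1" by (simp add: Q_def lead_coeff_mult lead_coeff_power lead_coeff_prod)
  have dQ: "degree Q = n"
  proof -
    have "degree (\<Prod>i<k. [:- xs i, 1:]) = k" by (subst degree_prod_sum_eq) auto
    then have "degree Q = k * (n div k) + n mod k"
      unfolding Q_def by (subst degree_mult_eq) (auto simp: degree_power_eq prod_zero_iff)
    then show ?thesis by simp
  qed
  define M where "M = max 1 (R / s) ^ k * s ^ n"
  have bound: "\<bar>poly Q x\<bar> \<le> M" if x: "x \<in> E" for x
  proof -
    have "\<bar>poly Q x\<bar> = (\<Prod>i<k. \<bar>x - xs i\<bar>) ^ (n div k) * \<bar>x - x0\<bar> ^ (n mod k)"
      by (simp add: Q_def abs_mult poly_prod abs_prod power_abs)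
    also have "\<dots> \<le> (s ^ k) ^ (n div k) * R ^ (n mod k)"
      using xs[OF x] R[OF x E(2)] s by (intro mult_mono power_mono) (auto intro!: prod_nonneg)
    also have "\<dots> = s ^ (k * (n div k)) * (s ^ (n mod k) * (R / s) ^ (n mod k))"
      using s by (simp add: power_mult flip: power_mult_distrib)
    also have "\<dots> = s ^ (k * (n div k) + n mod k) * (R / s) ^ (n mod k)"
      by (simp only: power_add mult.assoc)
    also have "k * (n div k) + n mod k = n" by simp
    also have "s ^ n * (R / s) ^ (n mod k) \<le> s ^ n * max 1 (R / s) ^ (n mod k)"
      using s R0 by (intro mult_left_mono power_mono) auto
    also have "\<dots> \<le> s ^ n * max 1 (R / s) ^ k"
      using s k by (intro mult_left_mono power_increasing) (auto intro: less_imp_le)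
    finally show ?thesis by (simp add: M_def mult.commute)
  qed
  have M0: "M \<ge> 0" using s by (simp add: M_def)
  have "(1 / lead_coeff (p n))\<^sup>2 \<le> (\<integral>x. (poly Q x)\<^sup>2 \<partial>mu)" by (rule monic_L2_ge[OF lQ dQ])
  also have "\<dots> \<le> (\<integral>x. M\<^sup>2 \<partial>mu)"
  proof (rule integral_mono_AE)
    show "integrable mu (\<lambda>x. (poly Q x)\<^sup>2)" using poly_mult_integrable[of Q Q] by (simp add: power2_eq_square)
    show "AE x in mu. (poly Q x)\<^sup>2 \<le> M\<^sup>2"
      using measure_support_AE[OF sets_mu] by eventually_elim (use bound E M0 in \<open>auto simp: abs_le_square_iff[symmetric]\<close>)
  qed simp
  also have "\<dots> = (sqrt (measure mu UNIV) * M)\<^sup>2" by (simp add: sp power_mult_distrib mult.commute)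
  finally have "1 / lead_coeff (p n) \<le> sqrt (measure mu UNIV) * M"
    by (rule power2_le_imp_le) (use M0 in simp)
  then show ?thesis by (simp add: M_def mult.assoc)
qed

text \<open>Each polynomial has norm 1 in \<open>L^2(mu)\<close>, so by Markov's inequality it
  exceeds \<open>K i\<close> on a set of measure at most \<open>1 / (K i)^2\<close>. These bounds
  are summable, and the Borel-Cantelli lemma applies.\<close>

lemma eventually_le_of_markov:
  assumes c: "0 < c" "c < 1" and K: "\<And>i. K i > 0" "\<And>i. 1 / (K i)\<^sup>2 \<le> D * c ^ i"
  shows "AE x in mu. \<forall>\<^sub>F i in sequentially. \<bar>poly (p (r i)) x\<bar> \<le> K i"
proof -
  interpret finite_measure mu by (rule finite_mu)
  note [measurable_cong] = sets_mu
  have pm[measurable]: "poly q \<in> borel_measurable borel" for q :: "real poly"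
    by (intro borel_measurable_continuous_onI continuous_intros)
  define A where "A i = {x\<in>space mu. (poly (p (r i)) x)\<^sup>2 \<ge> (K i)\<^sup>2}" for i
  have Am[measurable]: "A i \<in> sets mu" for i unfolding A_def by measurable
  have mA: "measure mu (A i) \<le> D * c ^ i" for i
  proof -
    have "measure mu (A i) \<le> (\<integral>x. (poly (p (r i)) x)\<^sup>2 \<partial>mu) / (K i)\<^sup>2"
      unfolding A_def
      by (rule integral_Markov_inequality_measure[of _ _ "{}"])
         (use poly_mult_integrable[of "p (r i)" "p (r i)"] K(1)[of i] in \<open>auto simp: power2_eq_square\<close>)
    also have "\<dots> = 1 / (K i)\<^sup>2" using orth[of "r i" "r i"] by (simp add: power2_eq_square)
    finally show ?thesis using K(2)[of i] by simp
  qed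
  have "AE x in mu. \<forall>\<^sub>F i in sequentially. x \<in> space mu - A i"
  proof (rule borel_cantelli_AE1)
    show "summable (\<lambda>i. measure mu (A i))"
    proof (rule summable_comparison_test')
      show "summable (\<lambda>i. D * c ^ i)" using c by (intro summable_mult summable_geometric) auto
      show "norm (measure mu (A i)) \<le> D * c ^ i" for i using mA by simp
    qed
  qed (auto simp: less_top[symmetric])
  then show ?thesis
  proof eventually_elim
    case (elim x)
    then show ?case
    proof eventually_elim
      case (elim i)
      then have "(poly (p (r i)) x)\<^sup>2 < (K i)\<^sup>2" by (auto simp: A_def)
      then show ?case using K(1)[of i] by (metis abs_le_square_iff abs_of_pos less_imp_le)
    qed
  qed
qed

end

section \<open>Root asymptotics or a carrier of capacity zero\<close>

text \<open>The empty set is always among the compact subsets, so the real supremum is taken over a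
  nonempty set, namely \<open>{0}\<close>.\<close>

lemma capacity_eq_0I:
  assumes "\<And>K. compact K \<Longrightarrow> K \<subseteq> X \<Longrightarrow> cap_compact K = 0"
  shows "capacity X = 0"
proof -
  have "cap_compact ` {K. compact K \<and> K \<subseteq> X} = {0}"
    using assms by (auto intro!: image_eqI[of _ _ "{}"] assms[symmetric])
  then show ?thesis by (simp add: capacity_def)
qed

theorem theorem2:
  fixes mu :: "real measure" and E :: "real set"
    and p :: "nat \<Rightarrow> real poly" and a b :: "nat \<Rightarrow> real"
    and nj :: "nat \<Rightarrow> nat" and rho :: "complex measure"
  assumes mu_borel: "sets mu = sets borel"
    and mu_finite: "finite_measure mu"
    and E_def: "E = measure_support mu"
    and E_compact: "compact E"
    and cap_pos: "cap_compact (complex_of_real ` E) > 0"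
    and ops: "orthonormal_polys mu p"
    and jac: "jacobi_parameters p a b"
    and sub: "strict_mono nj" "\<forall>j. nj j \<ge> 1"
    and equi: "equilibrium_measure (complex_of_real ` E) rho"
    and conv: "weak_conv_complex (\<lambda>j. zero_counting_measure (p (nj j))) rho"
  shows "(\<lambda>j. (\<Prod>i = 1..nj j. a i) powr (1 / real (nj j)))
            \<longlonglongrightarrow> cap_compact (complex_of_real ` E)
         \<or> (\<exists>X \<in> sets borel. X \<subseteq> E \<and> capacity (complex_of_real ` X) = 0
                              \<and> emeasure mu (UNIV - X) = 0)"
proof -
  interpret orthonormal_system mu p
    by (intro orthonormal_system.intro mu_borel mu_finite ops E_compact[unfolded E_def])
  note [measurable_cong] = mu_borel
  have spmu: "space mu = UNIV" using sets_eq_imp_space_eq[OF mu_borel] by simp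
  have Eb[measurable]: "E \<in> sets borel" using E_compact by (simp add: compact_imp_closed)
  obtain B0 where B0: "B0 > 0" "\<And>x. x \<in> E \<Longrightarrow> \<bar>x\<bar> \<le> B0"
    using compact_imp_bounded[OF E_compact] by (auto simp: bounded_pos)
  \<comment> \<open>Twice \<open>B0\<close> bounds the diameter of \<open>E\<close>; the extra 1
    gives \<open>R >= 1\<close>.\<close>
  define R where "R = 2 * B0 + 1"
  have R: "R \<ge> 1" "R > 0" using B0 by (auto simp: R_def)
  have RE: "\<bar>x - y\<bar> \<le> R" if "x \<in> E" "y \<in> E" for x y
    using B0(2)[OF that(1)] B0(2)[OF that(2)] by (auto simp: R_def)
  define C where "C = cap_compact (complex_of_real ` E)"
  have C0: "C > 0" using cap_pos by (simp add: C_def)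
  obtain V where V: "V \<ge> 0" "energy R (distr rho borel Re) = ennreal V"
    and CV': "cap_compact (complex_of_real ` E) = R * exp (- V)"
    and min': "\<forall>N. real_distribution N \<and> (AE x in N. x \<in> E) \<longrightarrow> ennreal V \<le> energy R N"
    by (rule equilibrium_energy[OF E_compact R(1) RE cap_pos equi])
  have min: "ennreal V \<le> energy R N" if "real_distribution N" "AE x in N. x \<in> E" for N
    using min' that by blast
  have CV: "C = R * exp (- V)" using CV' by (simp add: C_def)
  have rhoE: "rho \<in> prob_measures_on (complex_of_real ` E)"
    using equi by (simp add: equilibrium_measure_def)
  then have rho: "prob_space rho" "sets rho = sets borel" by (auto simp: prob_measures_on_def)
  have P: "real_distribution (distr rho borel Re)" and PE: "AE x in distr rho borel Re. x \<in> E"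
    by (rule real_distribution_distr_Re[OF rhoE Eb])+
  interpret P: real_distribution "distr rho borel Re" by (rule P)
  \<comment> \<open>Frostman's bound: minimality gives it almost everywhere, the maximum principle
    everywhere. A competitor absolutely continuous with respect to the projected \<open>rho\<close>
    is again carried by \<open>E\<close>.\<close>
  have pot: "log_pot R (distr rho borel Re) x \<le> ennreal V" for x
  proof (rule P.log_pot_le_everywhere[OF R(2) P.log_pot_minimizer_AE[OF R(2) V]])
    fix N assume N: "real_distribution N" "absolutely_continuous (distr rho borel Re) N"
    have "AE x in N. x \<in> E"
      by (rule absolutely_continuous_AE[OF _ N(2) PE]) (simp add: real_distribution.events_eq_borel[OF N(1)])
    then show "energy R (distr rho borel Re) \<le> energy R N" unfolding V(2) by (rule min[OF N(1)])
  qed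
  have "E \<noteq> {}"
  proof
    assume "E = {}"
    then have "AE x in distr rho borel Re. False" using PE by simp
    then show False by simp
  qed
  then obtain x0 where x0: "x0 \<in> E" by auto

  \<comment> \<open>Roots of the products of Jacobi parameters\<close>
  define L where "L j = (\<Prod>i = 1..nj j. a i) powr (1 / real (nj j))" for j
  define l0 where "l0 = lead_coeff (p 0)"
  have l0: "l0 > 0" by (simp add: l0_def lead)
  have nj1: "nj j \<ge> 1" for j using sub by simp
  have pos: "(\<Prod>i = 1..n. a i) > 0" for n using jac by (intro prod_pos) (auto simp: jacobi_parameters_def)
  have prod_eq: "(\<Prod>i = 1..n. a i) = l0 * (1 / lead_coeff (p n))" for n
  proof -
    have "(\<Prod>i = 1..n. a i) = l0 / lead_coeff (p n)"
    proof (rule eq_divide_imp)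
      show "lead_coeff (p n) \<noteq> 0" using lead[of n] by linarith
      show "(\<Prod>i = 1..n. a i) * lead_coeff (p n) = l0"
        unfolding l0_def by (subst mult.commute) (rule lead_prod_jacobi[OF jac])
    qed
    then show ?thesis by simp
  qed
  have Lpow: "L j ^ nj j = (\<Prod>i = 1..nj j. a i)" for j
  proof -
    have "L j > 0" unfolding L_def powr_gt_zero using pos[of "nj j"] by linarith
    then have "L j ^ nj j = L j powr real (nj j)" by (rule powr_realpow[symmetric])
    also have "\<dots> = (\<Prod>i = 1..nj j. a i) powr 1"
      using nj1[of j] unfolding L_def by (subst powr_powr) simp
    also have "\<dots> = (\<Prod>i = 1..nj j. a i)" by (intro powr_one less_imp_le[OF pos])
    finally show ?thesis .
  qed

  \<comment> \<open>Upper bound for the roots by the capacity\<close>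
  have upper: "\<forall>\<^sub>F j in sequentially. L j < T" if T: "T > C" for T
  proof -
    have "((\<lambda>e. R * exp (- (V - e))) \<longlongrightarrow> R * exp (- (V - 0))) (at_right 0)"
      by (intro tendsto_intros)
    then have "\<forall>\<^sub>F e in at_right 0. R * exp (- (V - e)) < T"
      using T by (intro order_tendstoD) (auto simp: CV)
    then have "\<forall>\<^sub>F e :: real in at_right 0. e > 0 \<and> R * exp (- (V - e)) < T"
      using eventually_at_right_less[of "0 :: real"] by eventually_elim auto
    then have "\<exists>e :: real. e > 0 \<and> R * exp (- (V - e)) < T"
      by (intro eventually_happens') auto
    then obtain e :: real where e: "e > 0" "R * exp (- (V - e)) < T" by blast
    define s where "s = R * exp (- (V - e))"
    have s: "s > 0" "s < T" using R e by (auto simp: s_def)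
    have "\<exists>k\<ge>1. \<exists>xs :: nat \<Rightarrow> real. \<forall>x\<in>E. (\<Prod>i<k. \<bar>x - xs i\<bar>) \<le> s ^ k"
      unfolding s_def by (rule small_polynomial_on_compact[OF E_compact \<open>E \<noteq> {}\<close> R(2) RE min e(1)])
    then obtain k :: nat and xs where k: "k \<ge> 1" and xs: "\<And>x. x \<in> E \<Longrightarrow> (\<Prod>i<k. \<bar>x - xs i\<bar>) \<le> s ^ k"
      by blast
    \<comment> \<open>All factors independent of \<open>j\<close> go into \<open>D\<close>, whose
      root of order \<open>nj j\<close> tends to 1; the added 1 makes \<open>D\<close>
      positive.\<close>
    define D where "D = l0 * (sqrt (measure mu UNIV) * max 1 (R / s) ^ k) + 1"
    have D: "D > 0" unfolding D_def using l0 by (intro add_nonneg_pos mult_nonneg_nonneg) auto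
    have Lle: "L j \<le> D powr (1 / real (nj j)) * s" for j
    proof -
      have "(\<Prod>i = 1..nj j. a i) \<le> l0 * (sqrt (measure mu UNIV) * max 1 (R / s) ^ k * s ^ nj j)"
        unfolding prod_eq
        by (rule mult_left_mono[OF lead_ge_of_small_polynomial[OF E_def x0 RE k s(1) xs] less_imp_le[OF l0]])
      also have "\<dots> \<le> D * s ^ nj j" using s by (simp add: D_def algebra_simps)
      finally have "L j \<le> (D * s ^ nj j) powr (1 / real (nj j))"
        unfolding L_def by (intro powr_mono2 less_imp_le[OF pos]) auto
      also have "\<dots> = D powr (1 / real (nj j)) * (s powr real (nj j)) powr (1 / real (nj j))"
        using D s(1) by (subst powr_mult) (simp_all add: powr_realpow)
      also have "(s powr real (nj j)) powr (1 / real (nj j)) = s"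
        using s(1) nj1[of j] by (subst powr_powr) simp
      finally show ?thesis .
    qed
    have "(\<lambda>n. D powr (1 / real n) * s) \<longlonglongrightarrow> D powr 0 * s"
      using D by (intro tendsto_intros lim_1_over_n) auto
    then have "(\<lambda>n. D powr (1 / real n) * s) \<longlonglongrightarrow> s" using D by simp
    from LIMSEQ_subseq_LIMSEQ[OF this sub(1)]
    have "\<forall>\<^sub>F j in sequentially. D powr (1 / real (nj j)) * s < T"
      using s by (intro order_tendstoD) (auto simp: o_def)
    then show ?thesis by eventually_elim (use Lle in \<open>auto intro: le_less_trans\<close>)
  qed

  \<comment> \<open>Construction of the carrier when the roots do not converge\<close>
  show ?thesis
  proof (cases "L \<longlonglongrightarrow> C")
    case True
    then show ?thesis by (simp add: L_def[abs_def] C_def)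
  next
    case False
    then obtain T where T: "T < C" "\<not> (\<forall>\<^sub>F j in sequentially. T < L j)"
      using upper by (auto simp: order_tendsto_iff)
    \<comment> \<open>By \<open>upper\<close>, only the lower bound can fail, so infinitely many
      roots are at most \<open>T < C\<close>. Taking the maximum with \<open>C / 2\<close> makes
      \<open>A\<close> positive, and \<open>B\<close> is the midpoint of \<open>A\<close> and
      \<open>C\<close>.\<close>
    define A where "A = max T (C / 2)"
    define B where "B = (A + C) / 2"
    have AB: "0 < A" "A < B" "B < C" using T C0 by (auto simp: A_def B_def)
    have "infinite {j. L j \<le> A}"
    proof
      assume "finite {j. L j \<le> A}"
      then obtain N where "\<forall>j\<in>{j. L j \<le> A}. j < N" by (auto simp: finite_nat_set_iff_bounded)
      then have "\<forall>j\<ge>N. T < L j" by (force simp: A_def not_le[symmetric])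
      then show False using T(2) by (auto simp: eventually_sequentially)
    qed
    then obtain r :: "nat \<Rightarrow> nat" where r: "strict_mono r" "\<And>i. L (r i) \<le> A"
      using infinite_enumerate[of "{j. L j \<le> A}"] by auto
    define n where "n i = nj (r i)" for i
    have n1: "n i \<ge> 1" for i unfolding n_def by (rule nj1)
    \<comment> \<open>This lets \<open>(A / B) ^ n i\<close> be replaced by
      \<open>(A / B) ^ i\<close>, a geometric series in the index of the subsequence.\<close>
    have n_ge: "i \<le> n i" for i
      using strict_mono_imp_increasing[OF strict_mono_compose[OF sub(1) r(1)]] by (simp add: n_def)
    \<comment> \<open>For the monic polynomial the bound \<open>K i\<close> reads
      \<open>B ^ n i\<close>. The reciprocal leading coefficient is at most
      \<open>A ^ n i / l0\<close>, so \<open>1 / K i\<close> decays like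
      \<open>(A / B) ^ n i\<close>.\<close>
    define K where "K i = lead_coeff (p (n i)) * B ^ n i" for i
    have K: "K i > 0" for i unfolding K_def using lead AB by simp
    have small: "AE x in mu. \<forall>\<^sub>F i in sequentially. \<bar>poly (p (n i)) x\<bar> \<le> K i"
    proof (rule eventually_le_of_markov[where c = "(A / B)\<^sup>2" and D = "1 / l0\<^sup>2"])
      show "0 < (A / B)\<^sup>2" "(A / B)\<^sup>2 < 1"
        using AB by (auto simp: power_less_one_iff abs_square_less_1)
      fix i
      have "L (r i) ^ n i \<le> A ^ n i" using r(2) by (intro power_mono) (auto simp: L_def)
      then have "l0 * (1 / lead_coeff (p (n i))) \<le> A ^ n i"
        using Lpow[of "r i"] prod_eq[of "n i"] by (simp add: n_def)
      then have "1 / lead_coeff (p (n i)) \<le> A ^ n i / l0"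
        using l0 by (subst pos_le_divide_eq) (simp_all add: mult.commute)
      then have "1 / lead_coeff (p (n i)) / B ^ n i \<le> A ^ n i / l0 / B ^ n i"
        using AB by (intro divide_right_mono) auto
      then have "1 / K i \<le> (A / B) ^ n i / l0" by (simp add: K_def power_divide mult.commute)
      also have "\<dots> \<le> (A / B) ^ i / l0"
        using AB l0 n_ge by (intro divide_right_mono power_decreasing) auto
      finally have "(1 / K i)\<^sup>2 \<le> ((A / B) ^ i / l0)\<^sup>2" using K[of i] by (intro power_mono) auto
      also have "((A / B) ^ i / l0)\<^sup>2 = 1 / l0\<^sup>2 * ((A / B)\<^sup>2) ^ i"
        by (simp only: power_divide power_mult[symmetric] mult.commute[of i]) simp
      finally show "1 / (K i)\<^sup>2 \<le> 1 / l0\<^sup>2 * ((A / B)\<^sup>2) ^ i"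
        by (simp add: power_one_over inverse_eq_divide)
    qed (rule K)
    define X where "X = {x\<in>E. \<forall>\<^sub>F i in sequentially. \<bar>poly (p (n i)) x\<bar> \<le> K i}"
    have [measurable]: "poly q \<in> borel_measurable borel" for q :: "real poly"
      by (intro borel_measurable_continuous_onI continuous_intros)
    have Xb[measurable]: "X \<in> sets borel"
    proof -
      have "X = {x \<in> space borel. x \<in> E \<and> (\<exists>N. \<forall>i\<ge>N. \<bar>poly (p (n i)) x\<bar> \<le> K i)}"
        by (auto simp: X_def eventually_sequentially)
      also have "\<dots> \<in> sets borel" by measurable
      finally show ?thesis .
    qed
    have "AE x in mu. x \<in> X"
      using small measure_support_AE[OF mu_borel] by eventually_elim (simp add: X_def E_def)
    then have "emeasure mu (UNIV - X) = 0"
      by (subst (asm) AE_iff_measurable[of "UNIV - X"]) (auto simp: spmu mu_borel)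
    moreover have "capacity (complex_of_real ` X) = 0"
    \<comment> \<open>A compact subset of nonzero capacity carries a measure \<open>N\<close> of
      finite energy, and the bound defining \<open>X\<close> holds \<open>N\<close>-almost
      everywhere. This would force \<open>C <= B\<close>, whereas \<open>B < C\<close>.\<close>
    proof (rule capacity_eq_0I, rule ccontr)
      fix F assume F: "compact F" "F \<subseteq> complex_of_real ` X" "cap_compact F \<noteq> 0"
      have FE: "F \<subseteq> complex_of_real ` E" using F(2) by (auto simp: X_def)
      obtain N where N: "real_distribution N" "AE x in N. complex_of_real x \<in> F" "energy R N < \<infinity>"
        using finite_energy_of_cap_pos[OF F(1) FE R(1) RE F(3)] by blast
      have "R * exp (- V) \<le> B"
      proof (rule equilibrium_root_asymptotics_le[where q = "\<lambda>i. p (n i)" and N = N and rho = rho])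
        show "weak_conv_complex (\<lambda>i. zero_counting_measure (p (n i))) rho"
          unfolding weak_conv_complex_def
        proof (intro allI impI)
          fix f :: "complex \<Rightarrow> real" assume "continuous_on UNIV f \<and> bounded (range f)"
          then have "(\<lambda>j. \<integral>x. f x \<partial>zero_counting_measure (p (nj j))) \<longlonglongrightarrow> (\<integral>x. f x \<partial>rho)"
            using conv unfolding weak_conv_complex_def by blast
          from LIMSEQ_subseq_LIMSEQ[OF this r(1)]
          show "(\<lambda>i. \<integral>x. f x \<partial>zero_counting_measure (p (n i))) \<longlonglongrightarrow> (\<integral>x. f x \<partial>rho)"
            by (simp add: n_def o_def)
        qed
        show "AE x in N. \<forall>\<^sub>F i in sequentially. \<bar>poly (p (n i)) x\<bar> \<le> lead_coeff (p (n i)) * B ^ degree (p (n i))"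
          using N(2)
        proof eventually_elim
          case (elim x)
          then have "x \<in> X" using F(2) by auto
          then show ?case by (simp add: X_def K_def deg)
        qed
        show "degree (p (n i)) \<ge> 1" for i unfolding deg by (rule n1)
        show "0 < B" using AB by simp
      qed (fact lead rho R V pot N)+
      then show False using AB CV by simp
    qed
    moreover have "X \<subseteq> E" by (auto simp: X_def)
    ultimately show ?thesis using Xb by blast
  qed
qed

end
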